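(* Let $G$ be a finite group and, for $n\ge0$, let $G_n=G\wr\mathfrak{S}_n$. For any integer $d\ge 0$, in $\mathbb{Z}[[q]]$, $$\sum_{n\ge 0}q^n\bigl|\mathrm{Hom}(\mathbb{Z}^d,G_n)/G_n\bigr|=\Bigl[\prod_{r\ge1}(1-q^r)^{j_r(\mathbb{Z}^d)}\Bigr]^{(-1)\,|\mathrm{Hom}(\mathbb{Z}^d,G)/G|},$$ where $j_r(\mathbb{Z}^d)$ is the number of index $r$ subgroups of $\mathbb{Z}^d$, given by $j_r(\mathbb{Z}^d)=\sum_{r_1r_2\cdots r_d=r}r_2r_3^2\cdots r_d^{d-1}$ (sum over ordered $d$-tuples of positive integers with product $r$).
   Context: For a group $H$, $\mathrm{Hom}(\mathbb{Z}^d,H)/H$ is the set of orbits of $H$ acting on $\mathrm{Hom}(\mathbb{Z}^d,H)$ by conjugation, i.e. the set of simultaneous conjugacy classes of $d$-tuples of mutually commuting elements of $H$. The wreath product $G\wr\mathfrak{S}_n=G^n\rtimes\mathfrak{S}_n$ is formed with respect to the permutation action $s(g_1,\dots,g_n)=(g_{s^{-1}(1)},\dots,g_{s^{-1}(n)})$ of the symmetric group $\mathfrak S_n$ on $G^n$; $G_0$ is the trivial group. For $d=0$, $j_1(\mathbb{Z}^0)=1$ and $j_r(\mathbb{Z}^0)=0$ for $r>1$. *)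

theory Defs
  imports
    "HOL-Analysis.Infinite_Products"
    "HOL-Computational_Algebra.Formal_Power_Series"
    "HOL-Algebra.Product_Groups"
    "HOL-Algebra.Group_Action"
    "HOL-Algebra.Sym_Groups"
begin

definition semidirect_product ::
  "('a, 'c) monoid_scheme \<Rightarrow> ('b, 'd) monoid_scheme \<Rightarrow> ('b \<Rightarrow> 'a \<Rightarrow> 'a) \<Rightarrow> ('a \<times> 'b) monoid"
  where "semidirect_product N S \<phi> =
    \<lparr>carrier = carrier N \<times> carrier S,
     monoid.mult = (\<lambda>(a, s) (b, t). (a \<otimes>\<^bsub>N\<^esub> \<phi> s b, s \<otimes>\<^bsub>S\<^esub> t)),
     one = (\<one>\<^bsub>N\<^esub>, \<one>\<^bsub>S\<^esub>)\<rparr>"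

text \<open>The \<open>inv_into UNIV s\<close> below is the inverse permutation
  (\<open>inv\<close> is taken by the group inverse).\<close>

definition wreath_product ::
  "('a, 'c) monoid_scheme \<Rightarrow> nat \<Rightarrow> ((nat \<Rightarrow> 'a) \<times> (nat \<Rightarrow> nat)) monoid"
  where "wreath_product G n =
    semidirect_product (product_group {1..n} (\<lambda>_. G)) (sym_group n)
      (\<lambda>s g. \<lambda>i\<in>{1..n}. g (inv_into UNIV s i))"

definition int_lattice :: "nat \<Rightarrow> (nat \<Rightarrow> int) monoid"
  where "int_lattice d = product_group {1..d} (\<lambda>_. integer_group)"

text \<open>\<open>hom K H\<close> does not constrain values outside \<open>carrier K\<close>; intersecting with
  \<open>extensional\<close> makes each homomorphism be counted exactly once.\<close>

definition Hom :: "('a, 'c) monoid_scheme \<Rightarrow> ('b, 'd) monoid_scheme \<Rightarrow> ('a \<Rightarrow> 'b) set"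
  where "Hom K H = hom K H \<inter> extensional (carrier K)"

definition conj_action ::
  "('a, 'c) monoid_scheme \<Rightarrow> ('b, 'd) monoid_scheme \<Rightarrow> 'b \<Rightarrow> ('a \<Rightarrow> 'b) \<Rightarrow> 'a \<Rightarrow> 'b"
  where "conj_action K H h f = (\<lambda>x\<in>carrier K. h \<otimes>\<^bsub>H\<^esub> f x \<otimes>\<^bsub>H\<^esub> inv\<^bsub>H\<^esub> h)"

definition Hom_classes ::
  "('a, 'c) monoid_scheme \<Rightarrow> ('b, 'd) monoid_scheme \<Rightarrow> ('a \<Rightarrow> 'b) set set"
  where "Hom_classes K H = orbits H (Hom K H) (conj_action K H)"

text \<open>An infinite coset space has \<open>card\<close> 0, so this is meaningful for \<open>r \<ge> 1\<close>.\<close>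

definition num_subgroups_of_index :: "nat \<Rightarrow> ('a, 'c) monoid_scheme \<Rightarrow> nat"
  where "num_subgroups_of_index r K = card {L. subgroup L K \<and> card (rcosets\<^bsub>K\<^esub> L) = r}"

text \<open>The ring \<open>int fps\<close> has no instance of class \<open>inverse\<close>, hence the inverse of a power series
  with constant coefficient 1 is taken from the ring-level library construction.\<close>

definition fps_inverse_const1 :: "int fps \<Rightarrow> int fps"
  where "fps_inverse_const1 f = fps_right_inverse f 1"

lemma fps_inverse_const1_right:
  assumes "fps_nth f 0 = 1"
  shows "f * fps_inverse_const1 f = 1"
  unfolding fps_inverse_const1_def using assms by (intro fps_right_inverse) simp

lemma group_semidirect_product:
  assumes N: "group N" and S: "group S"
    and hom: "\<And>s. s \<in> carrier S \<Longrightarrow> \<phi> s \<in> hom N N"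
    and one: "\<And>a. a \<in> carrier N \<Longrightarrow> \<phi> \<one>\<^bsub>S\<^esub> a = a"
    and mult: "\<And>s t a. \<lbrakk>s \<in> carrier S; t \<in> carrier S; a \<in> carrier N\<rbrakk>
                 \<Longrightarrow> \<phi> (s \<otimes>\<^bsub>S\<^esub> t) a = \<phi> s (\<phi> t a)"
  shows "group (semidirect_product N S \<phi>)"
proof -
  interpret N: group N by fact
  interpret S: group S by fact
  have c: "\<phi> s a \<in> carrier N" if "s \<in> carrier S" "a \<in> carrier N" for s a
    using hom_in_carrier[OF hom] that by blast
  have m: "\<phi> s (a \<otimes>\<^bsub>N\<^esub> b) = \<phi> s a \<otimes>\<^bsub>N\<^esub> \<phi> s b"
    if "s \<in> carrier S" "a \<in> carrier N" "b \<in> carrier N" for s a b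
    using hom_mult[OF hom] that by blast
  show ?thesis
  proof (rule groupI)
    fix x assume x: "x \<in> carrier (semidirect_product N S \<phi>)"
    obtain a s where as: "x = (a, s)" "a \<in> carrier N" "s \<in> carrier S"
      using x by (auto simp: semidirect_product_def)
    show "\<exists>y\<in>carrier (semidirect_product N S \<phi>).
            y \<otimes>\<^bsub>semidirect_product N S \<phi>\<^esub> x = \<one>\<^bsub>semidirect_product N S \<phi>\<^esub>"
      by (rule bexI[of _ "(inv\<^bsub>N\<^esub> (\<phi> (inv\<^bsub>S\<^esub> s) a), inv\<^bsub>S\<^esub> s)"])
         (use as c in \<open>auto simp: semidirect_product_def\<close>)
  qed (auto simp: semidirect_product_def c m one mult N.m_assoc S.m_assoc)
qed

lemma group_wreath_product:
  assumes "group G"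
  shows "group (wreath_product G n)"
  unfolding wreath_product_def
proof (rule group_semidirect_product)
  interpret G: group G by fact
  show "group (product_group {1..n} (\<lambda>_. G))"
    using assms by (simp add: product_group)
  show "group (sym_group n)" by (rule sym_group_is_group)
  have p: "inv_into UNIV s i \<in> {1..n}" if "s permutes {1..n}" "i \<in> {1..n}" for s i
    using permutes_in_image[OF permutes_inv[OF that(1)]] that(2) by blast
  show "(\<lambda>g. \<lambda>i\<in>{1..n}. g (inv_into UNIV s i))
      \<in> hom (product_group {1..n} (\<lambda>_. G)) (product_group {1..n} (\<lambda>_. G))"
    if "s \<in> carrier (sym_group n)" for s
    using p[of s] that unfolding hom_def
    by (auto simp: sym_group_def PiE_iff restrict_def fun_eq_iff)
  show "(\<lambda>i\<in>{1..n}. a (inv_into UNIV \<one>\<^bsub>sym_group n\<^esub> i)) = a"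
    if "a \<in> carrier (product_group {1..n} (\<lambda>_. G))" for a
    using that by (auto simp: sym_group_def fun_eq_iff PiE_iff extensional_def)
  show "(\<lambda>i\<in>{1..n}. a (inv_into UNIV (s \<otimes>\<^bsub>sym_group n\<^esub> t) i)) =
      (\<lambda>i\<in>{1..n}. (\<lambda>i\<in>{1..n}. a (inv_into UNIV t i)) (inv_into UNIV s i))"
    if "s \<in> carrier (sym_group n)" "t \<in> carrier (sym_group n)" for s t a
    using that p[of s] by (auto simp: sym_group_def fun_eq_iff o_inv_distrib permutes_bij)
qed

end

theory Submission
  imports Defs
begin

text \<open>
  By Burnside's lemma \<open>|Hom(\<int>\<^sup>d, H)/H| = |Hom(\<int>\<^sup>d\<^sup>+\<^sup>1, H)| / |H|\<close>, so it suffices to count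
  homomorphisms from \<open>A = \<int>\<^sup>d\<^sup>+\<^sup>1\<close> to \<open>G\<^sub>n\<close>, that is, actions of \<open>A\<close> on \<open>{1..n} \<times> G\<close> commuting with right
  translation by \<open>G\<close>. Choosing a base point splits such an action into the orbit of the base point,
  which is determined by its stabiliser \<open>L \<le> A\<close> of index \<open>r\<close>, a homomorphism \<open>L \<rightarrow> G\<close> and the positions
  of the \<open>r\<close> cosets of \<open>L\<close>, and an action on the remaining \<open>n - r\<close> blocks. As \<open>L \<cong> A\<close>, the number
  \<open>a\<^sub>n\<close> of conjugacy classes satisfies \<open>n a\<^sub>n = c (\<Sum>r=1..n. j\<^sub>r(\<int>\<^sup>d\<^sup>+\<^sup>1) a\<^bsub>n-r\<^esub>)\<close> with
  \<open>c = |Hom(\<int>\<^sup>d, G)/G|\<close>. Since \<open>j\<^sub>r(\<int>\<^sup>d\<^sup>+\<^sup>1)\<close> is the sum of \<open>k j\<^sub>k(\<int>\<^sup>d)\<close> over the divisors \<open>k\<close> of \<open>r\<close>,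
  this is the logarithmic derivative of the asserted product formula.
\<close>

section \<open>Infinite products of power series\<close>

text \<open>Conjugacy classes do not split canonically, but pointed actions do; this is why classes
  are traded for homomorphisms from a group of rank one higher. An action on n blocks has n |G|
  points, and |Hom(A, G_n)| = a_n |G|^n n!. On the other side, Hom(L, G) contributes c |G|, placing
  the r cosets of L contributes |G|^r n!/(n-r)!, and the other blocks contribute a_(n-r) |G|^(n-r)
  (n-r)!. Both sides share the factor |G|^(n+1) n!, and cancelling it leaves the recursion. The
  isomorphism of L with A and the divisor sum for j_r have one source: a subgroup of finite index in
  K x Z is given by a subgroup M of K, a height b and a coset of M, which is the Hermite normal form
  built row by row. A logarithm of power series would need denominators. The relation X f' = f s
  expresses the logarithmic derivative without dividing and stays within integer
  coefficients.\<close>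

lemma fps_log_deriv_mult:
  fixes f g s t :: "'a::comm_ring_1 fps"
  assumes "fps_X * fps_deriv f = f * s" "fps_X * fps_deriv g = g * t"
  shows "fps_X * fps_deriv (f * g) = f * g * (s + t)"
proof -
  have "fps_X * fps_deriv (f * g) = f * (fps_X * fps_deriv g) + (fps_X * fps_deriv f) * g"
    by (simp add: algebra_simps)
  then show ?thesis
    by (simp add: assms algebra_simps)
qed

lemma fps_log_deriv_power:
  fixes f s :: "'a::comm_ring_1 fps"
  assumes "fps_X * fps_deriv f = f * s"
  shows "fps_X * fps_deriv (f ^ n) = f ^ n * (of_nat n * s)"
proof (induction n)
  case (Suc n)
  show ?case
    using fps_log_deriv_mult[OF assms Suc] by (simp add: algebra_simps)
qed simp

lemma fps_log_deriv_prod: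
  fixes f s :: "'b \<Rightarrow> 'a::comm_ring_1 fps"
  assumes "\<And>i. i \<in> I \<Longrightarrow> fps_X * fps_deriv (f i) = f i * s i"
  shows "fps_X * fps_deriv (\<Prod>i\<in>I. f i) = (\<Prod>i\<in>I. f i) * (\<Sum>i\<in>I. s i)"
  using assms by (induction I rule: infinite_finite_induct) (simp_all add: fps_log_deriv_mult del: fps_deriv_mult)

text \<open>With m = \<open>Suc k\<close>, this is the geometric series of m X^m / (1 - X^m), which
  has coefficient m at the positive multiples of m. The guard \<open>0 < n\<close> removes index 0,
  a multiple of m as well. Multiplying by 1 - X^m telescopes, so no inverse has to be
  formed.\<close>

lemma fps_log_deriv_one_minus_X_power:
  "fps_X * fps_deriv (1 - fps_X ^ Suc k :: 'a::comm_ring_1 fps) =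
    (1 - fps_X ^ Suc k) * - Abs_fps (\<lambda>n. if 0 < n \<and> Suc k dvd n then of_nat (Suc k) else 0)"
    (is "_ = _ * - ?T")
proof -
  have "fps_nth ((1 - fps_X ^ Suc k) * ?T) n = fps_nth (of_nat (Suc k) * fps_X ^ Suc k) n" for n
  proof -
    have "fps_nth ((1 - fps_X ^ Suc k) * ?T) n =
        fps_nth ?T n - (if n < Suc k then 0 else fps_nth ?T (n - Suc k))"
      by (simp only: left_diff_distrib fps_sub_nth fps_X_power_mult_nth mult_1_left)
    also have "\<dots> = (if n = Suc k then of_nat (Suc k) else 0)"
    proof (cases "n \<le> Suc k")
      case True
      then show ?thesis by (auto dest: dvd_imp_le)
    next
      case False
      then have "Suc k dvd n \<longleftrightarrow> Suc k dvd n - Suc k"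
        by (simp add: dvd_minus_self)
      with False show ?thesis by auto
    qed
    also have "\<dots> = fps_nth (of_nat (Suc k) * fps_X ^ Suc k) n"
      by (simp only: fps_of_nat[symmetric] fps_mult_left_const_nth fps_X_power_nth) simp
    finally show ?thesis .
  qed
  then have "(1 - fps_X ^ Suc k) * ?T = of_nat (Suc k) * fps_X ^ Suc k"
    by (simp add: fps_eq_iff)
  moreover have "fps_X * fps_deriv (1 - fps_X ^ Suc k :: 'a fps) = - (of_nat (Suc k) * fps_X ^ Suc k)"
    by (simp only: fps_deriv_sub fps_deriv_1 fps_deriv_power' fps_deriv_fps_X diff_Suc_1)
      (simp add: algebra_simps)
  ultimately show ?thesis by simp
qed

section \<open>Euler products: truncation, convergence, logarithmic derivative\<close>

lemma fps_nth_euler_factor: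
  "n \<le> k \<Longrightarrow> fps_nth ((1 - fps_X ^ Suc k :: 'a::comm_ring_1 fps) ^ m) n = fps_nth 1 n"
proof (induction m arbitrary: n)
  case (Suc m)
  then show ?case
    by (subst power_Suc, simp only: left_diff_distrib fps_sub_nth fps_X_power_mult_nth mult_1_left)
      simp
qed simp

lemma fps_nth_mult_cong:
  fixes f g h :: "'a::comm_ring_1 fps"
  assumes "\<And>i. i \<le> n \<Longrightarrow> fps_nth g i = fps_nth h i"
  shows "fps_nth (f * g) n = fps_nth (f * h) n"
  using assms by (simp add: fps_mult_nth)

text \<open>Factors beyond the n-th are 1 modulo X^(n+1), so coefficient n can be read off a finite
  product. This gives the limit explicitly before any convergence is discussed.\<close>

definition euler_product :: "(nat \<Rightarrow> nat) \<Rightarrow> int fps" where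
  "euler_product j = Abs_fps (\<lambda>n. fps_nth (\<Prod>k<n. (1 - fps_X ^ Suc k) ^ j (Suc k)) n)"

lemma fps_nth_euler_product:
  "n \<le> N \<Longrightarrow> fps_nth (\<Prod>k<N. (1 - fps_X ^ Suc k) ^ j (Suc k)) n = fps_nth (euler_product j) n"
proof (induction N rule: dec_induct)
  case (step m)
  have "fps_nth (\<Prod>k<Suc m. (1 - fps_X ^ Suc k :: int fps) ^ j (Suc k)) n =
      fps_nth ((\<Prod>k<m. (1 - fps_X ^ Suc k) ^ j (Suc k)) * 1) n"
    unfolding prod.lessThan_Suc
  proof (rule fps_nth_mult_cong)
    fix i assume "i \<le> n"
    with step have "i \<le> m" by simp
    then show "fps_nth ((1 - fps_X ^ Suc m :: int fps) ^ j (Suc m)) i = fps_nth 1 i"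
      by (rule fps_nth_euler_factor)
  qed
  with step show ?case by simp
qed (simp add: euler_product_def)

lemma euler_product_nth_0: "fps_nth (euler_product j) 0 = 1"
  by (simp add: euler_product_def)

text \<open>Convergence holds because every coefficient is eventually constant. A product tending to
  0 would not count as convergent; the constant coefficient 1 of the limit excludes this.\<close>

lemma
  shows convergent_prod_euler:
      "convergent_prod (\<lambda>k. (1 - fps_X ^ Suc k :: int fps) ^ j (Suc k))"
    and prodinf_euler:
      "prodinf (\<lambda>k. (1 - fps_X ^ Suc k :: int fps) ^ j (Suc k)) = euler_product j"
proof -
  let ?f = "\<lambda>k. (1 - fps_X ^ Suc k :: int fps) ^ j (Suc k)"
  have "(\<lambda>N. \<Prod>k\<le>N. ?f k) \<longlonglongrightarrow> euler_product j"
    unfolding lessThan_Suc_atMost[symmetric]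
  proof (rule tendsto_fpsI)
    fix n
    show "\<forall>\<^sub>F N in sequentially. fps_nth (\<Prod>k<Suc N. ?f k) n = fps_nth (euler_product j) n"
      by (rule eventually_sequentiallyI[of n], rule fps_nth_euler_product) simp
  qed
  moreover have "euler_product j \<noteq> 0"
    using euler_product_nth_0[of j] by auto
  ultimately have raw: "raw_has_prod ?f 0 (euler_product j)"
    by (simp add: raw_has_prod_def)
  then show "convergent_prod ?f"
    by (auto simp: convergent_prod_def)
  \<comment> \<open>\<open>has_prod\<close> has a second alternative, a product with a zero factor;
    once it is excluded, uniqueness of limits decides.\<close>
  have nz: "?f k \<noteq> 0" for k
  proof
    assume "?f k = 0"
    then have "fps_nth (?f k) 0 = 0" by (simp only: fps_zero_nth)
    then show False by (subst (asm) fps_nth_euler_factor) simp_all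
  qed
  have "p = euler_product j" if "?f has_prod p" for p
    using that raw nz unfolding has_prod_def raw_has_prod_def
    by (auto intro: LIMSEQ_unique)
  then show "prodinf ?f = euler_product j"
    unfolding prodinf_def using raw by (intro the_equality) (auto simp: has_prod_def)
qed

text \<open>Coefficient n on either side involves only coefficients of the product up to n, so a
  finite product can stand in for it. There logarithmic derivatives add up, and the factor with
  exponent a contributes -a \<open>j a\<close> at each positive index divisible by a.\<close>

lemma euler_product_log_deriv:
  "fps_X * fps_deriv (euler_product j) =
    euler_product j * - Abs_fps (\<lambda>n. if n = 0 then 0 else \<Sum>a | a dvd n. int (a * j a))"
    (is "_ = _ * - ?S")
proof (rule fps_ext)
  fix n
  define PN where "PN = (\<Prod>k<Suc n. (1 - fps_X ^ Suc k :: int fps) ^ j (Suc k))"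
  define T where "T k = Abs_fps (\<lambda>i. if 0 < i \<and> Suc k dvd i then of_nat (Suc k) else 0 :: int)" for k
  have 1: "fps_X * fps_deriv PN = PN * (\<Sum>k<Suc n. of_nat (j (Suc k)) * - T k)"
    unfolding PN_def T_def
    by (intro fps_log_deriv_prod fps_log_deriv_power fps_log_deriv_one_minus_X_power)
  have 2: "fps_nth (\<Sum>k<Suc n. of_nat (j (Suc k)) * - T k) i = fps_nth (- ?S) i" if "i \<le> n" for i
  proof (cases "i = 0")
    case True
    then show ?thesis
      by (simp add: T_def fps_sum_nth fps_of_nat[symmetric] del: of_nat_Suc)
  next
    case False
    have *: "fps_nth (of_nat (j (Suc k)) * - T k) i =
        - (if Suc k dvd i then int (Suc k * j (Suc k)) else 0)" for k
      using False by (simp add: T_def fps_of_nat[symmetric] algebra_simps)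
    have "(\<Sum>k<Suc n. if Suc k dvd i then int (Suc k * j (Suc k)) else 0) =
        (\<Sum>k\<in>{k. k < Suc n \<and> Suc k dvd i}. int (Suc k * j (Suc k)))"
      by (intro sum.mono_neutral_cong_right) auto
    also have "\<dots> = (\<Sum>a | a dvd i. int (a * j a))"
    proof (rule sum.reindex_bij_witness[where i = "\<lambda>a. a - 1" and j = Suc])
      fix a assume "a \<in> {a. a dvd i}"
      with False have "0 < a" "a \<le> i" by (auto dest: dvd_imp_le intro: Nat.gr0I)
      with \<open>a \<in> _\<close> \<open>i \<le> n\<close> show "a - 1 \<in> {k. k < Suc n \<and> Suc k dvd i}" "Suc (a - 1) = a"
        by auto
    qed auto
    finally show ?thesis
      using False by (simp only: fps_sum_nth * sum_negf fps_neg_nth fps_nth_Abs_fps if_False)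
  qed
  have "fps_nth (fps_X * fps_deriv (euler_product j)) n = fps_nth (fps_X * fps_deriv PN) n"
    by (cases n) (simp_all add: PN_def fps_nth_euler_product del: prod.lessThan_Suc power_Suc)
  also have "\<dots> = fps_nth (PN * - ?S) n"
    unfolding 1 by (rule fps_nth_mult_cong) (rule 2)
  \<comment> \<open>\<open>fps_nth_mult_cong\<close> alters the right factor, so the product is
    turned around before \<open>PN\<close> is replaced.\<close>
  also have "\<dots> = fps_nth (- ?S * PN) n"
    by (simp only: mult.commute)
  also have "\<dots> = fps_nth (- ?S * euler_product j) n"
    unfolding PN_def by (intro fps_nth_mult_cong fps_nth_euler_product) simp
  finally show "fps_nth (fps_X * fps_deriv (euler_product j)) n = fps_nth (euler_product j * - ?S) n"
    by (simp only: mult.commute)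
qed

text \<open>The recursion is X A' = A (c S) read coefficientwise, while the Euler product satisfies
  X P' = -P S. Hence A P^c has logarithmic derivative 0; over the integers a vanishing derivative
  makes it constant, and the constant is 1.\<close>

lemma eq_inverse_euler_product_power:
  fixes a :: "nat \<Rightarrow> nat"
  assumes "a 0 = 1"
    and rec: "\<And>n. n * a n = c * (\<Sum>r=1..n. (\<Sum>k | k dvd r. k * j k) * a (n - r))"
  shows "Abs_fps (\<lambda>n. int (a n)) = fps_inverse_const1 (euler_product j) ^ c"
proof -
  let ?A = "Abs_fps (\<lambda>n. int (a n))"
  let ?P = "euler_product j"
  let ?S = "Abs_fps (\<lambda>n. if n = 0 then 0 else \<Sum>k | k dvd n. int (k * j k))"
  have "fps_nth (fps_X * fps_deriv ?A) n = fps_nth (?A * (of_nat c * ?S)) n" for n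
  proof -
    have "fps_nth (fps_X * fps_deriv ?A) n = int (n * a n)"
      by (cases n) (simp_all add: algebra_simps)
    also have "\<dots> = int c * (\<Sum>r=1..n. (\<Sum>k | k dvd r. int (k * j k)) * int (a (n - r)))"
      unfolding rec by simp
    \<comment> \<open>The index r = 0 may be added because S has constant coefficient 0.\<close>
    also have "(\<Sum>r=1..n. (\<Sum>k | k dvd r. int (k * j k)) * int (a (n - r))) =
        (\<Sum>r=0..n. fps_nth ?S r * fps_nth ?A (n - r))"
      by (intro sum.mono_neutral_cong_left) auto
    also have "\<dots> = fps_nth (?S * ?A) n"
      by (simp only: fps_mult_nth)
    also have "int c * \<dots> = fps_nth (of_nat c * (?S * ?A)) n"
      by (simp only: fps_of_nat[symmetric] fps_mult_left_const_nth)
    also have "of_nat c * (?S * ?A) = ?A * (of_nat c * ?S)"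
      by (simp only: ac_simps)
    finally show ?thesis .
  qed
  then have A: "fps_X * fps_deriv ?A = ?A * (of_nat c * ?S)"
    by (rule fps_ext)
  have "fps_X * fps_deriv (?A * ?P ^ c) = ?A * ?P ^ c * (of_nat c * ?S + of_nat c * - ?S)"
    by (intro fps_log_deriv_mult fps_log_deriv_power A euler_product_log_deriv)
  then have "fps_deriv (?A * ?P ^ c) = 0"
    by simp
  then have "?A * ?P ^ c = fps_const (fps_nth (?A * ?P ^ c) 0)"
    by (simp only: fps_deriv_eq_0_iff)
  then have 1: "?A * ?P ^ c = 1"
    by (simp add: euler_product_nth_0 fps_nth_power_0 assms(1))
  have "?A = ?A * (?P * fps_inverse_const1 ?P) ^ c"
    by (simp add: fps_inverse_const1_right euler_product_nth_0)
  also have "\<dots> = fps_inverse_const1 ?P ^ c"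
    using 1 by (simp add: power_mult_distrib mult.assoc[symmetric])
  finally show ?thesis .
qed

section \<open>Subgroups of finite index in lattices\<close>

text \<open>Maps with the same fibres have images in bijection. Indices are evaluated this way
  below: cosets are replaced by the values of a complete coset invariant.\<close>

lemma bij_betw_images_same_kernel:
  assumes "\<And>x y. x \<in> A \<Longrightarrow> y \<in> A \<Longrightarrow> f x = f y \<longleftrightarrow> g x = g y"
  shows "bij_betw (\<lambda>z. g (inv_into A f z)) (f ` A) (g ` A)"
proof -
  have "g (inv_into A f (f x)) = g x" if "x \<in> A" for x
    using that assms[of x "inv_into A f (f x)"] by (simp add: f_inv_into_f inv_into_into)
  then show ?thesis
    using assms by (auto simp: bij_betw_def inj_on_def image_image)
qed

lemma (in group) rcos_eq_iff:
  assumes "subgroup H G" "x \<in> carrier G" "y \<in> carrier G"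
  shows "H #> x = H #> y \<longleftrightarrow> x \<otimes> inv y \<in> H"
  by (metis assms group_axioms repr_independence repr_independenceD subgroup.rcos_module)

lemma (in group) bij_betw_rcosets:
  assumes "subgroup H G"
    and "\<And>x y. x \<in> carrier G \<Longrightarrow> y \<in> carrier G \<Longrightarrow> f x = f y \<longleftrightarrow> x \<otimes> inv y \<in> H"
  shows "\<exists>g. bij_betw g (rcosets H) (f ` carrier G)"
proof -
  have "rcosets H = (\<lambda>x. H #> x) ` carrier G"
    by (auto simp: RCOSETS_def)
  then show ?thesis
    using bij_betw_images_same_kernel[of "carrier G" "\<lambda>x. H #> x" f] assms
    by (auto simp: rcos_eq_iff)
qed

lemma (in group) card_rcosets_eq:
  assumes "subgroup H G"
    and "\<And>x y. x \<in> carrier G \<Longrightarrow> y \<in> carrier G \<Longrightarrow> f x = f y \<longleftrightarrow> x \<otimes> inv y \<in> H"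
  shows "card (rcosets H) = card (f ` carrier G)"
  using bij_betw_rcosets[OF assms] bij_betw_same_card by blast

abbreviation subgroups_of_index :: "nat \<Rightarrow> ('a, 'c) monoid_scheme \<Rightarrow> 'a set set" where
  "subgroups_of_index r K \<equiv> {L. subgroup L K \<and> card (rcosets\<^bsub>K\<^esub> L) = r}"

lemma bij_betw_subgroups_of_index:
  assumes "group K" "group K'" "\<phi> \<in> iso K K'"
  shows "bij_betw ((`) \<phi>) (subgroups_of_index r K) (subgroups_of_index r K')"
proof -
  \<comment> \<open>Stated for arbitrary groups, as it is applied both to \<open>\<phi>\<close> and
    to its inverse.\<close>
  have sub: "\<phi> ` L \<in> subgroups_of_index r K'"
    if "group K" "group K'" "\<phi> \<in> iso K K'" "L \<in> subgroups_of_index r K"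
    for \<phi> L and K :: "('x, 'y) monoid_scheme" and K' :: "('z, 'w) monoid_scheme"
  proof -
    interpret K: group K by fact
    interpret K': group K' by fact
    interpret \<phi>: group_hom K K' \<phi>
      using that by unfold_locales (simp add: iso_iff)
    from that have L: "subgroup L K" and inj: "inj_on \<phi> (carrier K)"
      and surj: "\<phi> ` carrier K = carrier K'"
      by (auto simp: iso_iff)
    have sub: "subgroup (\<phi> ` L) K'"
      using L by (rule \<phi>.subgroup_img_is_subgroup)
    have "card (rcosets\<^bsub>K\<^esub> L) = card ((\<lambda>x. \<phi> ` L #>\<^bsub>K'\<^esub> \<phi> x) ` carrier K)"
    proof (rule K.card_rcosets_eq[OF L])
      fix x y assume xy: "x \<in> carrier K" "y \<in> carrier K"
      then have "(\<phi> ` L #>\<^bsub>K'\<^esub> \<phi> x = \<phi> ` L #>\<^bsub>K'\<^esub> \<phi> y) \<longleftrightarrow> \<phi> (x \<otimes>\<^bsub>K\<^esub> inv\<^bsub>K\<^esub> y) \<in> \<phi> ` L"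
        by (simp add: K'.rcos_eq_iff[OF sub])
      also have "\<dots> \<longleftrightarrow> x \<otimes>\<^bsub>K\<^esub> inv\<^bsub>K\<^esub> y \<in> L"
        using xy by (intro inj_on_image_mem_iff[OF inj _ subgroup.subset[OF L]]) simp
      finally show "(\<phi> ` L #>\<^bsub>K'\<^esub> \<phi> x = \<phi> ` L #>\<^bsub>K'\<^esub> \<phi> y) \<longleftrightarrow> x \<otimes>\<^bsub>K\<^esub> inv\<^bsub>K\<^esub> y \<in> L" .
    qed
    also have "(\<lambda>x. \<phi> ` L #>\<^bsub>K'\<^esub> \<phi> x) ` carrier K = rcosets\<^bsub>K'\<^esub> (\<phi> ` L)"
      by (auto simp: RCOSETS_def simp flip: surj)
    finally show ?thesis
      using that sub by simp
  qed
  let ?\<psi> = "inv_into (carrier K) \<phi>"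
  have \<psi>: "?\<psi> \<in> iso K' K"
    by (rule group.iso_set_sym) fact+
  show ?thesis
  proof (rule bij_betw_byWitness[where f' = "(`) ?\<psi>"])
    from assms(3) have inj: "inj_on \<phi> (carrier K)" and surj: "\<phi> ` carrier K = carrier K'"
      by (auto simp: iso_iff)
    show "\<forall>L\<in>subgroups_of_index r K. ?\<psi> ` \<phi> ` L = L"
      using inj by (auto dest!: subgroup.subset)
    show "\<forall>L\<in>subgroups_of_index r K'. \<phi> ` ?\<psi> ` L = L"
      using surj by (metis (no_types, lifting) image_inv_into_cancel mem_Collect_eq subgroup.subset)
    show "(`) \<phi> ` subgroups_of_index r K \<subseteq> subgroups_of_index r K'"
      using sub[OF assms] by blast
    show "(`) ?\<psi> ` subgroups_of_index r K' \<subseteq> subgroups_of_index r K"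
      using sub[OF assms(2,1) \<psi>] by blast
  qed
qed

lemma bij_betw_Hom_iso:
  assumes "group K" "\<phi> \<in> iso K K'"
  shows "bij_betw (\<lambda>f. restrict (f \<circ> \<phi>) (carrier K)) (Hom K' H) (Hom K H)"
proof (rule bij_betw_byWitness)
  let ?\<psi> = "inv_into (carrier K) \<phi>"
  have \<psi>: "?\<psi> \<in> iso K' K"
    by (rule group.iso_set_sym) fact+
  from assms(2) have \<phi>: "\<phi> \<in> hom K K'" and inj: "inj_on \<phi> (carrier K)"
    and surj: "\<phi> ` carrier K = carrier K'"
    by (auto simp: iso_iff)
  from \<psi> have \<psi>': "?\<psi> \<in> hom K' K"
    by (auto simp: iso_iff)
  have cK: "x \<otimes>\<^bsub>K\<^esub> y \<in> carrier K" if "x \<in> carrier K" "y \<in> carrier K" for x y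
    using that group.is_monoid[OF assms(1)] by (simp add: monoid.m_closed)
  \<comment> \<open>Products in K' are images of products in K, which gives closure of its
    carrier.\<close>
  have "x \<otimes>\<^bsub>K'\<^esub> y \<in> carrier K'" if xy: "x \<in> carrier K'" "y \<in> carrier K'" for x y
  proof -
    from xy surj obtain x' y' where "x' \<in> carrier K" "y' \<in> carrier K" "x = \<phi> x'" "y = \<phi> y'"
      by blast
    then show ?thesis
      using hom_mult[OF \<phi>, of x' y'] hom_in_carrier[OF \<phi> cK, of x' y'] by simp
  qed
  then show "(\<lambda>f. restrict (f \<circ> ?\<psi>) (carrier K')) ` Hom K H \<subseteq> Hom K' H"
    using \<psi>' by (auto simp: Hom_def hom_def Pi_iff)
  show "(\<lambda>f. restrict (f \<circ> \<phi>) (carrier K)) ` Hom K' H \<subseteq> Hom K H"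
    using \<phi> cK by (auto simp: Hom_def hom_def Pi_iff)
  have inv1: "\<phi> (?\<psi> x) = x" if "x \<in> carrier K'" for x
    using that surj by (simp add: f_inv_into_f)
  have inv2: "?\<psi> (\<phi> x) = x" if "x \<in> carrier K" for x
    using that inj by simp
  show "\<forall>f\<in>Hom K' H. restrict (restrict (f \<circ> \<phi>) (carrier K) \<circ> ?\<psi>) (carrier K') = f"
    using \<psi>' by (auto simp: Hom_def hom_def Pi_iff fun_eq_iff inv1 extensional_def)
  show "\<forall>f\<in>Hom K H. restrict (restrict (f \<circ> ?\<psi>) (carrier K') \<circ> \<phi>) (carrier K) = f"
    using \<phi> by (auto simp: Hom_def hom_def Pi_iff fun_eq_iff inv2 extensional_def)
qed

lemma int_lattice_Suc_iso:
  "(\<lambda>x. (restrict x {1..d}, x (Suc d))) \<in> iso (int_lattice (Suc d)) (int_lattice d \<times>\<times> integer_group)"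
proof (rule isoI)
  have S: "{1..Suc d} = insert (Suc d) {1..d}" by auto
  show "(\<lambda>x. (restrict x {1..d}, x (Suc d))) \<in> hom (int_lattice (Suc d)) (int_lattice d \<times>\<times> integer_group)"
    by (auto simp: hom_def int_lattice_def fun_eq_iff)
  show "bij_betw (\<lambda>x. (restrict x {1..d}, x (Suc d))) (carrier (int_lattice (Suc d)))
      (carrier (int_lattice d \<times>\<times> integer_group))"
    by (rule bij_betw_byWitness[where f' = "\<lambda>(x, m). x(Suc d := m)"])
      (auto simp: int_lattice_def fun_eq_iff PiE_iff extensional_def)
qed

lemma comm_group_int_lattice: "comm_group (int_lattice d)"
proof (rule group.group_comm_groupI)
  show "group (int_lattice d)"
    by (simp add: int_lattice_def)
qed (auto simp: int_lattice_def fun_eq_iff)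

section \<open>Subgroups of finite index in a product with the integers\<close>

context comm_group begin

text \<open>The subgroup of all \<open>(k v\<^sup>m, m b)\<close> with \<open>k \<in> M\<close> and \<open>m \<in> \<int>\<close>; every subgroup of finite index of
  \<open>G \<times> \<int>\<close> has this form, with \<open>v\<close> unique modulo \<open>M\<close>.\<close>

definition split_subgroup :: "'a set \<Rightarrow> nat \<Rightarrow> 'a \<Rightarrow> ('a \<times> int) set" where
  "split_subgroup M b v =
    {(x, y). x \<in> carrier G \<and> int b dvd y \<and> x \<otimes> inv (v [^] (y div int b)) \<in> M}"

lemma group_times_int: "group (G \<times>\<times> integer_group)"
  by (rule DirProd_group) (simp_all add: is_group)

lemma comm_group_times_int: "comm_group (G \<times>\<times> integer_group)"
  by (rule group.group_comm_groupI[OF group_times_int]) (auto simp: m_comm)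

text \<open>The shear taking (x, b s) to (x v^(-s), s) straightens
  \<open>split_subgroup M b v\<close> to M x Z. This lemma and \<open>shear_inv\<close> are its
  compatibility with the group operations and rest on commutativity.\<close>

lemma shear_mult:
  assumes "v \<in> carrier G" "x \<in> carrier G" "x' \<in> carrier G"
  shows "(x \<otimes> x') \<otimes> inv (v [^] (s + s' :: int)) = (x \<otimes> inv (v [^] s)) \<otimes> (x' \<otimes> inv (v [^] s'))"
  using assms by (simp add: int_pow_mult inv_mult m_ac)

lemma shear_inv:
  assumes "v \<in> carrier G" "x \<in> carrier G"
  shows "inv x \<otimes> inv (v [^] (- s :: int)) = inv (x \<otimes> inv (v [^] s))"
  using assms by (simp add: int_pow_neg inv_mult)

lemma subgroup_split_subgroup:
  assumes "subgroup M G" "0 < b" "v \<in> carrier G"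
  shows "subgroup (split_subgroup M b v) (G \<times>\<times> integer_group)"
proof -
  interpret M: subgroup M G by fact
  show ?thesis
  proof (rule group.subgroupI[OF group_times_int])
    have "(\<one>, 0) \<in> split_subgroup M b v"
      by (simp add: split_subgroup_def)
    then show "split_subgroup M b v \<noteq> {}" by blast
    show "split_subgroup M b v \<subseteq> carrier (G \<times>\<times> integer_group)"
      by (auto simp: split_subgroup_def)
  next
    fix a assume "a \<in> split_subgroup M b v"
    then obtain x s where a: "a = (x, int b * s)" "x \<in> carrier G" "x \<otimes> inv (v [^] s) \<in> M"
      using assms(2) by (auto simp: split_subgroup_def elim!: dvdE)
    have "(- (int b * s)) div int b = - s"
      using assms(2) by (metis mult_minus_right nonzero_mult_div_cancel_left of_nat_0_less_iff order_less_irrefl)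
    with a assms show "inv\<^bsub>G \<times>\<times> integer_group\<^esub> a \<in> split_subgroup M b v"
      by (simp add: inv_DirProd is_group split_subgroup_def shear_inv)
  next
    fix a a' assume "a \<in> split_subgroup M b v" "a' \<in> split_subgroup M b v"
    then obtain x s x' s' where a: "a = (x, int b * s)" "x \<in> carrier G" "x \<otimes> inv (v [^] s) \<in> M"
      "a' = (x', int b * s')" "x' \<in> carrier G" "x' \<otimes> inv (v [^] s') \<in> M"
      using assms(2) by (auto simp: split_subgroup_def elim!: dvdE)
    have "(int b * s + int b * s') div int b = s + s'"
      using assms(2) by (simp flip: distrib_left)
    with a assms show "a \<otimes>\<^bsub>G \<times>\<times> integer_group\<^esub> a' \<in> split_subgroup M b v"
      by (simp add: split_subgroup_def shear_mult)
  qed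
qed

text \<open>A complete invariant of the coset of (x, y) is the residue of y modulo b together with
  the M-coset of x, sheared by the quotient of y by b.\<close>

lemma card_rcosets_split_subgroup:
  assumes "subgroup M G" "0 < b" "v \<in> carrier G"
  shows "card (rcosets\<^bsub>G \<times>\<times> integer_group\<^esub> split_subgroup M b v) = b * card (rcosets M)"
proof -
  let ?f = "\<lambda>(x, y). (y mod int b, M #> (x \<otimes> inv (v [^] (y div int b))))"
  have "card (rcosets\<^bsub>G \<times>\<times> integer_group\<^esub> split_subgroup M b v) =
      card (?f ` carrier (G \<times>\<times> integer_group))"
  proof (rule group.card_rcosets_eq[OF group_times_int subgroup_split_subgroup[OF assms]])
    fix p p' assume "p \<in> carrier (G \<times>\<times> integer_group)" "p' \<in> carrier (G \<times>\<times> integer_group)"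
    then obtain x y x' y' where p: "p = (x, y)" "p' = (x', y')" "x \<in> carrier G" "x' \<in> carrier G"
      by auto
    \<comment> \<open>Quotients by b subtract exactly when the residues agree, and only then are the
      second components compared.\<close>
    have eq: "(x \<otimes> inv (v [^] (y div int b))) \<otimes> inv (x' \<otimes> inv (v [^] (y' div int b))) =
        (x \<otimes> inv x') \<otimes> inv (v [^] ((y - y') div int b))" if "y mod int b = y' mod int b"
    proof -
      from that have "int b dvd y - y'"
        by (simp add: mod_eq_dvd_iff)
      then obtain k where "y = y' + int b * k"
        by (metis dvdE diff_eq_eq add.commute)
      then have "(y - y') div int b = y div int b + - (y' div int b)"
        using assms(2) by simp
      then show ?thesis
        using p assms(3) by (simp only: shear_mult[OF assms(3)] inv_closed shear_inv)
    qed
    have "?f p = ?f p' \<longleftrightarrow> int b dvd y - y' \<and> (x \<otimes> inv x') \<otimes> inv (v [^] ((y - y') div int b)) \<in> M"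
      using p assms eq by (auto simp: rcos_eq_iff mod_eq_dvd_iff)
    then show "?f p = ?f p' \<longleftrightarrow>
        p \<otimes>\<^bsub>G \<times>\<times> integer_group\<^esub> inv\<^bsub>G \<times>\<times> integer_group\<^esub> p' \<in> split_subgroup M b v"
      using p by (simp add: split_subgroup_def inv_DirProd is_group)
  qed
  also have "?f ` carrier (G \<times>\<times> integer_group) = {0..<int b} \<times> rcosets M"
  proof (intro equalityI subsetI)
    fix z assume "z \<in> {0..<int b} \<times> rcosets M"
    then obtain m x where z: "z = (m, M #> x)" "0 \<le> m" "m < int b" "x \<in> carrier G"
      by (auto simp: RCOSETS_def)
    then have "z = ?f (x, m)"
      by simp
    with z show "z \<in> ?f ` carrier (G \<times>\<times> integer_group)"
      by (intro image_eqI[of _ _ "(x, m)"]) auto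
  qed (use assms in \<open>force simp: RCOSETS_def\<close>)
  also have "card \<dots> = b * card (rcosets M)"
    by (simp add: card_cartesian_product)
  finally show ?thesis .
qed

text \<open>M is the slice at height 0, and the slice at height b is M v. Each of (v, b) and (v',
  b') lies in the subgroup, so b and b' divide each other.\<close>

lemma split_subgroup_eqD:
  assumes "split_subgroup M b v = split_subgroup M' b' v'"
    and "subgroup M G" "0 < b" "v \<in> carrier G" "subgroup M' G" "0 < b'" "v' \<in> carrier G"
  shows "M = M'" "b = b'" "M #> v = M #> v'"
proof -
  have zero: "(x, 0) \<in> split_subgroup M b v \<longleftrightarrow> x \<in> M" if "subgroup M G" "v \<in> carrier G" for M b v x
    using that by (auto simp: split_subgroup_def subgroup.mem_carrier)
  show M: "M = M'"
    using zero[of M v _ b] zero[of M' v' _ b'] assms by auto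
  have gen: "(v, int b) \<in> split_subgroup M b v" if "subgroup M G" "0 < b" "v \<in> carrier G" for M b v
    using that by (simp add: split_subgroup_def subgroup.one_closed)
  from gen[of M b v] gen[of M' b' v'] assms have
    *: "(v, int b) \<in> split_subgroup M' b' v'" "(v', int b') \<in> split_subgroup M b v"
    by auto
  then show b: "b = b'"
    by (auto simp: split_subgroup_def intro: dvd_antisym)
  show "M #> v = M #> v'"
    using * assms by (simp add: split_subgroup_def rcos_eq_iff flip: M b)
qed

text \<open>One row of the Hermite normal form: b is the least positive height occurring in L, and
  (v, b) is any element at that height. Returning the whole coset C instead of v makes the data
  canonical, while every representative still describes L.\<close>

lemma subgroup_times_int_cases:
  assumes L: "subgroup L (G \<times>\<times> integer_group)"
    and fin: "0 < card (rcosets\<^bsub>G \<times>\<times> integer_group\<^esub> L)"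
  obtains M b C where "subgroup M G" "0 < b" "C \<in> rcosets M"
    "\<And>v. v \<in> C \<Longrightarrow> L = split_subgroup M b v"
proof -
  interpret A: comm_group "G \<times>\<times> integer_group"
    by (rule comm_group_times_int)
  interpret L: subgroup L "G \<times>\<times> integer_group" by fact
  have Linv: "(inv x, - y) \<in> L" if "(x, y) \<in> L" for x y
    using L.m_inv_closed[OF that] L.mem_carrier[OF that] by (simp add: inv_DirProd is_group)
  have Lmult: "(x \<otimes> x', y + y') \<in> L" if "(x, y) \<in> L" "(x', y') \<in> L" for x y x' y'
    using L.m_closed[OF that] by simp
  have Lpow: "(x [^] s, s * y) \<in> L" if "(x, y) \<in> L" for x y and s :: int
  proof -
    have xy: "(x, y) \<in> carrier (G \<times>\<times> integer_group)"
      using that by (rule L.mem_carrier)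
    have "fst \<in> hom (G \<times>\<times> integer_group) G" "snd \<in> hom (G \<times>\<times> integer_group) integer_group"
      by (auto simp: hom_def)
    from hom_int_pow[OF this(1) xy group_times_int is_group, of s]
      hom_int_pow[OF this(2) xy group_times_int group_integer_group, of s]
    have "(x, y) [^]\<^bsub>G \<times>\<times> integer_group\<^esub> s = (x [^] s, s * y)"
      by (simp add: prod_eq_iff)
    with A.subgroup_int_pow_closed[OF L that, of s] show ?thesis
      by simp
  qed
  define M where "M = {x. (x, 0) \<in> L}"
  have M: "subgroup M G"
    using L.one_closed Linv[of _ 0] Lmult[of _ 0 _ 0] L.mem_carrier
    by (intro subgroupI) (fastforce simp: M_def)+
  define P where "P b \<longleftrightarrow> 0 < b \<and> (\<exists>x. (x, int b) \<in> L)" for b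
  \<comment> \<open>Pigeonhole: as there are finitely many cosets, two of the elements (1, n) share
    one, and their quotient lies in L at a positive height.\<close>
  have "\<exists>b. P b"
  proof -
    let ?c = "\<lambda>n::nat. L #>\<^bsub>G \<times>\<times> integer_group\<^esub> (\<one>, int n)"
    have "finite (range ?c)"
      using fin by (intro finite_subset[OF _ card_ge_0_finite[OF fin]]) (auto simp: RCOSETS_def)
    then have "\<not> inj ?c"
      using finite_imageD infinite_UNIV_nat by blast
    then obtain m n where mn: "m < n" "?c n = ?c m"
      by (metis (no_types, lifting) injI linorder_neqE_nat)
    then have "(\<one>, int n) \<otimes>\<^bsub>G \<times>\<times> integer_group\<^esub> inv\<^bsub>G \<times>\<times> integer_group\<^esub> (\<one>, int m) \<in> L"
      by (subst (asm) A.rcos_eq_iff[OF L]) auto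
    with mn have "P (n - m)"
      by (auto simp: P_def inv_DirProd is_group of_nat_diff)
    then show ?thesis ..
  qed
  define b where "b = (LEAST b. P b)"
  have "P b"
    unfolding b_def using \<open>\<exists>b. P b\<close> by (rule LeastI_ex)
  then obtain v where b: "0 < b" and v: "(v, int b) \<in> L"
    by (auto simp: P_def)
  have vc: "v \<in> carrier G"
    using L.mem_carrier[OF v] by simp
  \<comment> \<open>Euclidean division: removing a multiple of (v, b) leaves an element at height y
    mod b, which must be 0 by minimality of b.\<close>
  have dvd: "int b dvd y" if "(x, y) \<in> L" for x y
  proof -
    have "(x \<otimes> inv (v [^] (y div int b)), y + - (y div int b * int b)) \<in> L"
      by (intro Lmult that Linv Lpow v)
    also have "y + - (y div int b * int b) = y mod int b"
      by (simp add: minus_div_mult_eq_mod)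
    finally have "\<not> 0 < nat (y mod int b) \<or> b \<le> nat (y mod int b)"
      unfolding b_def by (metis P_def Least_le b_def b nat_0_le pos_mod_sign of_nat_0_less_iff)
    moreover have "nat (y mod int b) < b" "0 \<le> y mod int b"
      using b by (simp_all add: nat_less_iff)
    ultimately show ?thesis
      by (simp add: dvd_eq_mod_eq_0)
  qed
  show thesis
  proof (rule that[of M b "M #> v"])
    show "M #> v \<in> rcosets M"
      using vc M by (simp add: rcosetsI subgroup.subset)
    fix w assume "w \<in> M #> v"
    then obtain m where m: "(m, 0) \<in> L" "w = m \<otimes> v"
      by (auto simp: r_coset_def M_def)
    then have w: "(w, int b) \<in> L"
      using Lmult[OF m(1) v] by simp
    then have wc: "w \<in> carrier G"
      using L.mem_carrier by fastforce
    show "L = split_subgroup M b w"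
    proof (intro equalityI subsetI)
      fix p assume p: "p \<in> L"
      then obtain x s where xs: "p = (x, s * int b)"
        using dvd by (metis dvdE mult.commute prod.collapse)
      have "(x \<otimes> inv (w [^] s), s * int b + - (s * int b)) \<in> L"
        using p xs by (intro Lmult Linv Lpow w) simp
      with p xs b show "p \<in> split_subgroup M b w"
        using L.mem_carrier[OF p] by (simp add: split_subgroup_def M_def)
    next
      fix p assume "p \<in> split_subgroup M b w"
      then obtain x s where xs: "p = (x, s * int b)" "x \<in> carrier G" "(x \<otimes> inv (w [^] s), 0) \<in> L"
        using b by (auto simp: split_subgroup_def M_def elim!: dvdE)
      have "((x \<otimes> inv (w [^] s)) \<otimes> w [^] s, 0 + s * int b) \<in> L"
        by (intro Lmult Lpow w xs)
      then show "p \<in> L"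
        using xs wc by (simp add: m_assoc)
    qed
  qed (use M b in auto)
qed

text \<open>This is the shear again; it lets an induction on the rank pass from a subgroup of G x Z
  to one of G.\<close>

lemma split_subgroup_iso:
  assumes "subgroup M G" "0 < b" "v \<in> carrier G"
  shows "(G \<times>\<times> integer_group)\<lparr>carrier := split_subgroup M b v\<rparr> \<cong> G\<lparr>carrier := M\<rparr> \<times>\<times> integer_group"
proof (rule is_isoI, rule isoI)
  let ?A = "(G \<times>\<times> integer_group)\<lparr>carrier := split_subgroup M b v\<rparr>"
  let ?f = "\<lambda>(x, y). (x \<otimes> inv (v [^] (y div int b)), y div int b)"
  show "?f \<in> hom ?A (G\<lparr>carrier := M\<rparr> \<times>\<times> integer_group)"
    unfolding hom_def
    using assms by (auto simp: split_subgroup_def shear_mult)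
  show "bij_betw ?f (carrier ?A) (carrier (G\<lparr>carrier := M\<rparr> \<times>\<times> integer_group))"
  proof (rule bij_betw_byWitness[where f' = "\<lambda>(x, s). (x \<otimes> v [^] s, s * int b)"])
    show "(\<lambda>(x, s). (x \<otimes> v [^] s, s * int b)) ` carrier (G\<lparr>carrier := M\<rparr> \<times>\<times> integer_group) \<subseteq> carrier ?A"
      using assms by (auto simp: split_subgroup_def subgroup.mem_carrier m_assoc)
  qed (use assms in \<open>auto simp: split_subgroup_def subgroup.mem_carrier m_assoc\<close>)
qed

text \<open>For fixed M and b, the vectors v matter only modulo M, so cosets C in place of vectors
  list every subgroup once. Any representative of C serves, by
  \<open>subgroup_times_int_cases\<close> and \<open>split_subgroup_eqD\<close>.\<close>

lemma bij_betw_split_subgroups: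
  assumes "0 < r"
  shows "bij_betw (\<lambda>(b, M, C). split_subgroup M b (SOME v. v \<in> C))
    (SIGMA b:{b. b dvd r}. SIGMA M:subgroups_of_index (r div b) G. rcosets M)
    (subgroups_of_index r (G \<times>\<times> integer_group))"
    (is "bij_betw ?f ?X ?Y")
proof -
  have some: "(SOME v. v \<in> C) \<in> carrier G \<and> C = M #> (SOME v. v \<in> C) \<and> (SOME v. v \<in> C) \<in> C"
    if "subgroup M G" "C \<in> rcosets M" for M C
  proof -
    from that obtain x where x: "x \<in> carrier G" "C = M #> x"
      by (auto simp: RCOSETS_def)
    have "(SOME v. v \<in> C) \<in> C"
      using rcos_self[OF x(1) that(1)] x by (metis someI)
    with x that show ?thesis
      by (metis is_group repr_independence subgroup.elemrcos_carrier)
  qed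
  show ?thesis
    unfolding bij_betw_def
  proof (intro conjI equalityI subsetI)
    show "inj_on ?f ?X"
    proof (rule inj_onI, clarsimp, goal_cases)
      case (1 b M C b' M' C')
      with assms have "0 < b" "0 < b'"
        by (auto intro!: Nat.gr0I)
      with 1 split_subgroup_eqD[of M b "SOME v. v \<in> C" M' b' "SOME v. v \<in> C'"]
        some[of M C] some[of M' C']
      show ?case by auto
    qed
  next
    fix L assume "L \<in> ?f ` ?X"
    then obtain b M C where L: "b dvd r" "subgroup M G" "card (rcosets M) = r div b"
      "C \<in> rcosets M" "L = split_subgroup M b (SOME v. v \<in> C)"
      by auto
    moreover have "0 < b"
      using assms L by (auto intro!: Nat.gr0I)
    ultimately show "L \<in> ?Y"
      using some[of M C] by (simp add: subgroup_split_subgroup card_rcosets_split_subgroup)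
  next
    fix L assume L: "L \<in> ?Y"
    with assms obtain M b C where M: "subgroup M G" "0 < b" "C \<in> rcosets M"
      "\<And>v. v \<in> C \<Longrightarrow> L = split_subgroup M b v"
      by (auto elim: subgroup_times_int_cases)
    then have eq: "L = split_subgroup M b (SOME v. v \<in> C)"
      using some[of M C] by blast
    then have "r = b * card (rcosets M)"
      using L M some[of M C] by (auto simp: card_rcosets_split_subgroup)
    with M have "(b, M, C) \<in> ?X"
      by auto
    with eq show "L \<in> ?f ` ?X"
      by (intro image_eqI[of _ _ "(b, M, C)"]) auto
  qed
qed

text \<open>Each M of index a = r div b admits a cosets C, whence the weight a; the sum over b is
  then reindexed by b -> r div b.\<close>

lemma
  assumes "0 < r" and fin: "\<And>a. 0 < a \<Longrightarrow> finite (subgroups_of_index a G)"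
  shows finite_subgroups_of_index_times_int: "finite (subgroups_of_index r (G \<times>\<times> integer_group))"
    and num_subgroups_of_index_times_int:
      "num_subgroups_of_index r (G \<times>\<times> integer_group) = (\<Sum>a | a dvd r. a * num_subgroups_of_index a G)"
proof -
  have pos: "0 < r div b" if "b dvd r" for b
    using that assms(1) by (metis dvd_div_eq_0_iff not_gr_zero)
  have fin1: "finite (rcosets M)" if "M \<in> subgroups_of_index (r div b) G" "b dvd r" for M b
    using that pos[of b] by (auto intro: card_ge_0_finite)
  have fin2: "finite {b. b dvd r}"
    using assms(1) by simp
  have fin3: "finite (SIGMA M:subgroups_of_index (r div b) G. rcosets M)" if "b dvd r" for b
    using fin[OF pos[OF that]] fin1[OF _ that] by (rule finite_SigmaI)
  note bij = bij_betw_split_subgroups[OF assms(1)]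
  show "finite (subgroups_of_index r (G \<times>\<times> integer_group))"
    unfolding bij_betw_finite[OF bij, symmetric] using fin2
    by (rule finite_SigmaI) (use fin3 in simp)
  have "num_subgroups_of_index r (G \<times>\<times> integer_group) =
      (\<Sum>b | b dvd r. card (SIGMA M:subgroups_of_index (r div b) G. rcosets M))"
    unfolding num_subgroups_of_index_def bij_betw_same_card[OF bij, symmetric]
    using fin2 fin3 by (intro card_SigmaI) auto
  also have "\<dots> = (\<Sum>b | b dvd r. (r div b) * num_subgroups_of_index (r div b) G)"
  proof (rule sum.cong[OF refl])
    fix b assume "b \<in> {b. b dvd r}"
    then have b: "b dvd r"
      by simp
    have "card (SIGMA M:subgroups_of_index (r div b) G. rcosets M) =
        (\<Sum>M\<in>subgroups_of_index (r div b) G. card (rcosets M))"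
      using fin[OF pos[OF b]] fin1[OF _ b] by (intro card_SigmaI) blast+
    also have "\<dots> = (\<Sum>M\<in>subgroups_of_index (r div b) G. r div b)"
      by (rule sum.cong) auto
    finally show "card (SIGMA M:subgroups_of_index (r div b) G. rcosets M) =
        (r div b) * num_subgroups_of_index (r div b) G"
      by (simp add: num_subgroups_of_index_def)
  qed
  also have "\<dots> = (\<Sum>a | a dvd r. a * num_subgroups_of_index a G)"
    using assms(1)
    by (intro sum.reindex_bij_witness[where i = "\<lambda>b. r div b" and j = "\<lambda>b. r div b"])
      (auto elim!: dvdE)
  finally show "num_subgroups_of_index r (G \<times>\<times> integer_group) =
      (\<Sum>a | a dvd r. a * num_subgroups_of_index a G)" .
qed

end

section \<open>Lattices of all ranks, by splitting off the last coordinate\<close>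

lemma int_lattice_0: "carrier (int_lattice 0) = {\<one>\<^bsub>int_lattice 0\<^esub>}"
  by (simp add: int_lattice_def restrict_def)

lemma subgroups_of_index_int_lattice_0:
  "subgroups_of_index r (int_lattice 0) = (if r = 1 then {carrier (int_lattice 0)} else {})"
proof -
  interpret comm_group "int_lattice 0"
    by (rule comm_group_int_lattice)
  have 1: "subgroup L (int_lattice 0) \<longleftrightarrow> L = carrier (int_lattice 0)" for L
    using subgroup_self subgroup.subset[of L "int_lattice 0"] subgroup.one_closed[of L "int_lattice 0"]
    unfolding int_lattice_0 by auto
  have "card (rcosets\<^bsub>int_lattice 0\<^esub> (carrier (int_lattice 0))) = card ((\<lambda>x. ()) ` carrier (int_lattice 0))"
    by (rule card_rcosets_eq) (auto simp: subgroup_self)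
  then have "card (rcosets\<^bsub>int_lattice 0\<^esub> (carrier (int_lattice 0))) = 1"
    by (simp add: int_lattice_0)
  with 1 show ?thesis
    by auto
qed

lemma finite_subgroups_of_index_int_lattice:
  "0 < r \<Longrightarrow> finite (subgroups_of_index r (int_lattice d))"
proof (induction d arbitrary: r)
  case 0
  show ?case by (simp add: subgroups_of_index_int_lattice_0)
next
  case (Suc d)
  interpret comm_group "int_lattice d"
    by (rule comm_group_int_lattice)
  have "finite (subgroups_of_index r (int_lattice d \<times>\<times> integer_group))"
    using Suc by (intro finite_subgroups_of_index_times_int)
  then show ?case
    using bij_betw_finite[OF bij_betw_subgroups_of_index[OF _ group_times_int int_lattice_Suc_iso]]
      comm_group_int_lattice[of "Suc d"] by (simp add: comm_group_def)
qed

lemma num_subgroups_of_index_int_lattice_Suc: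
  assumes "0 < r"
  shows "num_subgroups_of_index r (int_lattice (Suc d)) =
    (\<Sum>a | a dvd r. a * num_subgroups_of_index a (int_lattice d))"
proof -
  interpret comm_group "int_lattice d"
    by (rule comm_group_int_lattice)
  have "num_subgroups_of_index r (int_lattice (Suc d)) =
      num_subgroups_of_index r (int_lattice d \<times>\<times> integer_group)"
    unfolding num_subgroups_of_index_def
    using comm_group_int_lattice[of "Suc d"]
    by (intro bij_betw_same_card[OF bij_betw_subgroups_of_index[OF _ group_times_int int_lattice_Suc_iso]])
      (simp add: comm_group_def)
  also have "\<dots> = (\<Sum>a | a dvd r. a * num_subgroups_of_index a (int_lattice d))"
    using assms by (intro num_subgroups_of_index_times_int finite_subgroups_of_index_int_lattice)
  finally show ?thesis .
qed

text \<open>Induction on the rank: L becomes a split subgroup, hence isomorphic to M x Z. Its index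
  is b times that of M, so M has finite index in Z^d and is itself a copy of Z^d.\<close>

lemma finite_index_subgroup_int_lattice_iso:
  assumes "subgroup L (int_lattice d)" "0 < card (rcosets\<^bsub>int_lattice d\<^esub> L)"
  shows "(int_lattice d)\<lparr>carrier := L\<rparr> \<cong> int_lattice d"
  using assms
proof (induction d arbitrary: L)
  case 0
  then have "L = carrier (int_lattice 0)"
    using subgroups_of_index_int_lattice_0[of "card (rcosets\<^bsub>int_lattice 0\<^esub> L)"]
    by (auto split: if_splits)
  then show ?case
    by simp
next
  case (Suc d)
  interpret comm_group "int_lattice d"
    by (rule comm_group_int_lattice)
  interpret S: comm_group "int_lattice (Suc d)"
    by (rule comm_group_int_lattice)
  let ?\<phi> = "\<lambda>x. (restrict x {1..d}, x (Suc d))" and ?A = "int_lattice d \<times>\<times> integer_group"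
  let ?L = "?\<phi> ` L"
  note iso = int_lattice_Suc_iso[of d]
  have "?L \<in> subgroups_of_index (card (rcosets\<^bsub>int_lattice (Suc d)\<^esub> L)) ?A"
    using bij_betw_subgroups_of_index[OF S.is_group group_times_int iso] Suc.prems
    unfolding bij_betw_def by blast
  then have L: "subgroup ?L ?A" "0 < card (rcosets\<^bsub>?A\<^esub> ?L)"
    using Suc.prems by auto
  then obtain M b C where M: "subgroup M (int_lattice d)" "0 < b" "C \<in> rcosets\<^bsub>int_lattice d\<^esub> M"
    "\<And>v. v \<in> C \<Longrightarrow> ?L = split_subgroup M b v"
    by (rule subgroup_times_int_cases) blast
  then obtain v where v: "v \<in> carrier (int_lattice d)" "?L = split_subgroup M b v"
    by (auto simp: RCOSETS_def dest: rcos_self)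
  with L M have "0 < card (rcosets\<^bsub>int_lattice d\<^esub> M)"
    by (simp add: card_rcosets_split_subgroup)
  with M have IH: "(int_lattice d)\<lparr>carrier := M\<rparr> \<cong> int_lattice d"
    by (intro Suc.IH)
  have "(int_lattice (Suc d))\<lparr>carrier := L\<rparr> \<cong> ?A\<lparr>carrier := ?L\<rparr>"
    using iso_restrict[OF iso S.is_group group_times_int Suc.prems(1)] by (rule is_isoI)
  also have "?A\<lparr>carrier := ?L\<rparr> \<cong> (int_lattice d)\<lparr>carrier := M\<rparr> \<times>\<times> integer_group"
    unfolding v(2) by (intro split_subgroup_iso M v)
  also have "(int_lattice d)\<lparr>carrier := M\<rparr> \<times>\<times> integer_group \<cong> ?A"
    using IH by (intro group.DirProd_iso_trans subgroup.subgroup_is_group[OF M(1)] is_group) auto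
  also have "?A \<cong> int_lattice (Suc d)"
    using is_isoI[OF iso] by (rule S.iso_sym)
  finally show ?case .
qed

text \<open>The divisor sum is iterated. In rank d+1 the divisor a is the product of all entries but
  the first, which is r div a. The weight a raises the exponent of each other entry by one, matching
  the shift of its position.\<close>

lemma num_subgroups_of_index_int_lattice:
  assumes "0 < r"
  shows "num_subgroups_of_index r (int_lattice d) =
    (\<Sum>t \<in> {t \<in> {1..d} \<rightarrow>\<^sub>E {1..}. (\<Prod>i\<in>{1..d}. t i) = r}. \<Prod>i\<in>{1..d}. t i ^ (i - 1))"
  using assms
proof (induction d arbitrary: r)
  case 0
  \<comment> \<open>In rank 0 the only tuple is the undefined function, with empty product
    1.\<close>
  have "{t. t = (\<lambda>x. undefined) \<and> r = Suc 0} = (if r = 1 then {\<lambda>x. undefined} else {})"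
    by auto
  then show ?case
    by (simp add: num_subgroups_of_index_def subgroups_of_index_int_lattice_0)
next
  case (Suc d)
  let ?T = "\<lambda>(d::nat) r. {t \<in> {1..d} \<rightarrow>\<^sub>E {1..}. (\<Prod>i\<in>{1..d}. t i) = (r::nat)}"
  have finT: "finite (?T d r)" if "0 < r" for d r
  proof (rule finite_subset)
    show "?T d r \<subseteq> {1..d} \<rightarrow>\<^sub>E {1..r}"
    proof
      fix t assume t: "t \<in> ?T d r"
      have "t i \<le> r" if "i \<in> {1..d}" for i
        using t \<open>0 < r\<close> dvd_prodI[OF finite_atLeastAtMost that, of t] by (simp add: dvd_imp_le)
      with t show "t \<in> {1..d} \<rightarrow>\<^sub>E {1..r}"
        by (simp add: PiE_iff)
    qed
  qed (simp add: finite_PiE)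
  have shift: "prod g {1..Suc d} = g 1 * (\<Prod>i=1..d. g (Suc i))" for g :: "nat \<Rightarrow> nat"
    using prod.atLeast_Suc_atMost[of 1 "Suc d" g] by (simp only: prod.shift_bounds_cl_Suc_ivl)
  have pos: "0 < a" if "a dvd r" for a
    using that Suc.prems by (auto intro!: Nat.gr0I)
  have "num_subgroups_of_index r (int_lattice (Suc d)) =
      (\<Sum>a | a dvd r. \<Sum>t\<in>?T d a. a * (\<Prod>i\<in>{1..d}. t i ^ (i - 1)))"
    unfolding num_subgroups_of_index_int_lattice_Suc[OF Suc.prems] sum_distrib_left[symmetric]
    using Suc.IH pos by (intro sum.cong) auto
  also have "\<dots> = (\<Sum>(a, t)\<in>(SIGMA a:{a. a dvd r}. ?T d a). a * (\<Prod>i\<in>{1..d}. t i ^ (i - 1)))"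
    using Suc.prems finT pos by (intro sum.Sigma) auto
  also have "\<dots> = (\<Sum>t\<in>?T (Suc d) r. \<Prod>i\<in>{1..Suc d}. t i ^ (i - 1))"
  proof (rule sum.reindex_bij_witness[where
        i = "\<lambda>t. (\<Prod>i=1..d. t (Suc i), \<lambda>i\<in>{1..d}. t (Suc i))" and
        j = "\<lambda>(a, t). \<lambda>i\<in>{1..Suc d}. if i = 1 then r div a else t (i - 1)"])
    fix p assume "p \<in> (SIGMA a:{a. a dvd r}. ?T d a)"
    then obtain a t where p: "p = (a, t)" "a dvd r" "t \<in> {1..d} \<rightarrow>\<^sub>E {1..}" "(\<Prod>i=1..d. t i) = a"
      by auto
    let ?j = "\<lambda>(a, t). \<lambda>i\<in>{1..Suc d}. if i = 1 then r div a else t (i - 1)"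
    have s: "?j p (Suc i) = t i" if "i \<in> {1..d}" for i
      using that p by auto
    have a: "(\<Prod>i=1..d. ?j p (Suc i)) = a"
      unfolding p(4)[symmetric] by (rule prod.cong[OF refl s])
    have "(\<lambda>i\<in>{1..d}. ?j p (Suc i)) = t"
      using p(1,3) by (auto simp: fun_eq_iff PiE_iff extensional_def)
    with a show "(\<Prod>i=1..d. ?j p (Suc i), \<lambda>i\<in>{1..d}. ?j p (Suc i)) = p"
      by (simp only: p(1))
    have "prod (?j p) {1..Suc d} = r"
      unfolding shift a using p by simp
    moreover have "1 \<le> r div a"
      using p(2) Suc.prems by (metis One_nat_def Suc_leI dvd_div_eq_0_iff not_gr_zero)
    moreover have "1 \<le> t (i - 1)" if "i \<in> {1..Suc d}" "i \<noteq> 1" for i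
      using that p(3) by (intro atLeast_iff[THEN iffD1] PiE_mem[OF p(3)]) auto
    ultimately show "?j p \<in> ?T (Suc d) r"
      using p(1) by (simp add: PiE_iff del: prod.cl_ivl_Suc)
    \<comment> \<open>The first entry has exponent 0 and drops out.\<close>
    have "(\<Prod>i\<in>{1..Suc d}. ?j p i ^ (i - 1)) = (\<Prod>i=1..d. ?j p (Suc i) ^ i)"
      unfolding shift by simp
    also have "\<dots> = (\<Prod>i=1..d. t i ^ i)"
      by (intro prod.cong arg_cong2[of _ _ _ _ "(^)"] refl s)
    also have "\<dots> = (\<Prod>i=1..d. t i * t i ^ (i - 1))"
      by (intro prod.cong) (auto simp: power_eq_if)
    finally show "(\<Prod>i\<in>{1..Suc d}. ?j p i ^ (i - 1)) =
        (case p of (a, t) \<Rightarrow> a * (\<Prod>i\<in>{1..d}. t i ^ (i - 1)))"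
      using p by (simp add: prod.distrib)
  next
    fix t assume t: "t \<in> ?T (Suc d) r"
    let ?a = "\<Prod>i=1..d. t (Suc i)"
    have r: "r = t 1 * ?a"
      using t unfolding shift by simp
    with Suc.prems have "0 < ?a" "r div ?a = t 1"
      by auto
    with t show "(case (?a, \<lambda>i\<in>{1..d}. t (Suc i)) of (a, t) \<Rightarrow>
        \<lambda>i\<in>{1..Suc d}. if i = 1 then r div a else t (i - 1)) = t"
      by (auto simp: fun_eq_iff PiE_iff extensional_def)
    show "(?a, \<lambda>i\<in>{1..d}. t (Suc i)) \<in> (SIGMA a:{a. a dvd r}. ?T d a)"
      using t r by (auto simp: PiE_iff)
  qed
  finally show ?case .
qed

section \<open>Homomorphisms and conjugacy classes\<close>

lemma (in group) inv_commute:
  assumes "x \<otimes> y = y \<otimes> x" "x \<in> carrier G" "y \<in> carrier G"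
  shows "inv x \<otimes> y = y \<otimes> inv x"
  using assms by (metis inv_closed inv_solve_left inv_solve_right m_assoc m_closed)

lemma (in group) int_pow_commute:
  assumes "x \<otimes> y = y \<otimes> x" "x \<in> carrier G" "y \<in> carrier G"
  shows "x [^] (m::int) \<otimes> y = y \<otimes> x [^] m"
proof -
  have *: "x [^] n \<otimes> y = y \<otimes> x [^] n" for n :: nat
  proof (induction n)
    case (Suc n)
    have "x [^] Suc n \<otimes> y = x [^] n \<otimes> (y \<otimes> x)"
      using assms by (simp add: m_assoc)
    also have "\<dots> = y \<otimes> x [^] Suc n"
      using Suc assms by (simp flip: m_assoc)
    finally show ?case .
  qed (use assms in simp)
  show ?thesis
  proof (cases "m < 0")
    case True
    then show ?thesis
      using inv_commute[OF *[of "nat (- m)"] nat_pow_closed[OF assms(2)] assms(3)]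
      by (simp only: int_pow_def2 if_True)
  next
    case False
    then show ?thesis
      using *[of "nat m"] by (simp only: int_pow_def2 if_False)
  qed
qed

lemma HomD:
  assumes "f \<in> Hom K H"
  shows "\<And>x. x \<in> carrier K \<Longrightarrow> f x \<in> carrier H"
    "\<And>x y. x \<in> carrier K \<Longrightarrow> y \<in> carrier K \<Longrightarrow> f (x \<otimes>\<^bsub>K\<^esub> y) = f x \<otimes>\<^bsub>H\<^esub> f y"
    "f \<in> extensional (carrier K)"
  using assms by (auto simp: Hom_def hom_def)

lemma conj_action_in_Hom:
  assumes "group K" "group H" "h \<in> carrier H" "f \<in> Hom K H"
  shows "conj_action K H h f \<in> Hom K H"
proof -
  interpret K: group K by fact
  interpret H: group H by fact
  note [simp] = HomD(1,2)[OF assms(4)]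
  have "h \<otimes>\<^bsub>H\<^esub> (a \<otimes>\<^bsub>H\<^esub> b) \<otimes>\<^bsub>H\<^esub> inv\<^bsub>H\<^esub> h =
      (h \<otimes>\<^bsub>H\<^esub> a \<otimes>\<^bsub>H\<^esub> inv\<^bsub>H\<^esub> h) \<otimes>\<^bsub>H\<^esub> (h \<otimes>\<^bsub>H\<^esub> b \<otimes>\<^bsub>H\<^esub> inv\<^bsub>H\<^esub> h)"
    if "a \<in> carrier H" "b \<in> carrier H" for a b
    using that assms(3) by (metis (no_types, lifting) H.inv_closed H.inv_solve_left H.m_assoc H.m_closed)
  then show ?thesis
    using assms(3) by (auto simp: Hom_def hom_def conj_action_def)
qed

lemma conj_action_mult:
  assumes "group H" "g \<in> carrier H" "h \<in> carrier H" "f \<in> Hom K H"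
  shows "conj_action K H (g \<otimes>\<^bsub>H\<^esub> h) f = conj_action K H g (conj_action K H h f)"
proof -
  interpret H: group H by fact
  show ?thesis
    using assms HomD(1)[OF assms(4)]
    by (auto simp: conj_action_def H.inv_mult_group H.m_assoc fun_eq_iff)
qed

lemma conj_action_one:
  assumes "group H" "f \<in> Hom K H"
  shows "conj_action K H \<one>\<^bsub>H\<^esub> f = f"
proof -
  interpret H: group H by fact
  show ?thesis
    using HomD(1,3)[OF assms(2)]
    by (auto simp: conj_action_def fun_eq_iff extensional_def)
qed

text \<open>\<open>BijGroup\<close> consists of extensional bijections, hence the restriction;
  \<open>orbits_restrict_conj_action\<close> shows that the orbits are still those of
  \<open>Hom_classes\<close>.\<close>

lemma group_action_conj_action:
  assumes "group K" "group H"
  shows "group_action H (Hom K H) (\<lambda>h. restrict (conj_action K H h) (Hom K H))"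
proof -
  interpret H: group H by fact
  have bij: "restrict (conj_action K H h) (Hom K H) \<in> Bij (Hom K H)" if "h \<in> carrier H" for h
  proof -
    have "bij_betw (conj_action K H h) (Hom K H) (Hom K H)"
    proof (rule bij_betw_byWitness[where f' = "conj_action K H (inv\<^bsub>H\<^esub> h)"])
      show "\<forall>f\<in>Hom K H. conj_action K H (inv\<^bsub>H\<^esub> h) (conj_action K H h f) = f"
        using that by (simp add: conj_action_one[OF assms(2)] flip: conj_action_mult[OF assms(2)])
      show "\<forall>f\<in>Hom K H. conj_action K H h (conj_action K H (inv\<^bsub>H\<^esub> h) f) = f"
        using that by (simp add: conj_action_one[OF assms(2)] flip: conj_action_mult[OF assms(2)])
    qed (use that conj_action_in_Hom[OF assms] in auto)
    then show ?thesis
      by (simp add: Bij_def cong: bij_betw_cong)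
  qed
  show ?thesis
  proof (intro group_action.intro group_hom.intro group_hom_axioms.intro group_BijGroup assms(2) homI)
    fix g h assume gh: "g \<in> carrier H" "h \<in> carrier H"
    then show "restrict (conj_action K H (g \<otimes>\<^bsub>H\<^esub> h)) (Hom K H) =
        restrict (conj_action K H g) (Hom K H) \<otimes>\<^bsub>BijGroup (Hom K H)\<^esub> restrict (conj_action K H h) (Hom K H)"
      using bij[OF gh(1)] bij[OF gh(2)] conj_action_in_Hom[OF assms]
      by (auto simp: BijGroup_def compose_def fun_eq_iff conj_action_mult[OF assms(2)])
  qed (use bij in \<open>simp add: BijGroup_def\<close>)
qed

lemma orbits_restrict_conj_action:
  "orbits H (Hom K H) (\<lambda>h. restrict (conj_action K H h) (Hom K H)) = Hom_classes K H"
  unfolding Hom_classes_def orbits_def orbit_def by force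

text \<open>A homomorphism on K x Z amounts to a homomorphism f on K and an image h of the generator
  of Z that commutes with the values of f, so that conjugation by h fixes f. The right side is
  therefore what Burnside's lemma counts.\<close>

lemma bij_betw_Hom_times_int:
  assumes "group K" "group H"
  shows "bij_betw (\<lambda>F. (F (\<one>\<^bsub>K\<^esub>, 1), \<lambda>k\<in>carrier K. F (k, 0))) (Hom (K \<times>\<times> integer_group) H)
    (SIGMA h:carrier H. invariants (Hom K H) (\<lambda>h. restrict (conj_action K H h) (Hom K H)) h)"
    (is "bij_betw ?f ?X ?Y")
proof -
  interpret K: group K by fact
  interpret H: group H by fact
  have inv: "f \<in> invariants (Hom K H) (\<lambda>h. restrict (conj_action K H h) (Hom K H)) h \<longleftrightarrow>
      f \<in> Hom K H \<and> (\<forall>k\<in>carrier K. h \<otimes>\<^bsub>H\<^esub> f k = f k \<otimes>\<^bsub>H\<^esub> h)" if h: "h \<in> carrier H" for f h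
  proof (cases "f \<in> Hom K H")
    case True
    have "h \<otimes>\<^bsub>H\<^esub> f k \<otimes>\<^bsub>H\<^esub> inv\<^bsub>H\<^esub> h = f k \<longleftrightarrow> h \<otimes>\<^bsub>H\<^esub> f k = f k \<otimes>\<^bsub>H\<^esub> h" if "k \<in> carrier K" for k
      using h HomD(1)[OF True that] H.inv_solve_right'[of "f k" "h \<otimes>\<^bsub>H\<^esub> f k" h] by auto
    with True HomD(3)[OF True] show ?thesis
      by (auto simp: invariants_def conj_action_def fun_eq_iff extensional_def)
  qed (simp add: invariants_def)
  have F: "F (k, m) = F (k, 0) \<otimes>\<^bsub>H\<^esub> F (\<one>\<^bsub>K\<^esub>, 1) [^]\<^bsub>H\<^esub> m"
    if "F \<in> ?X" "k \<in> carrier K" for F k and m :: int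
  proof -
    have "F (\<one>\<^bsub>K\<^esub>, i + j) = F (\<one>\<^bsub>K\<^esub>, i) \<otimes>\<^bsub>H\<^esub> F (\<one>\<^bsub>K\<^esub>, j)" for i j
      using HomD(2)[OF that(1), of "(\<one>\<^bsub>K\<^esub>, i)" "(\<one>\<^bsub>K\<^esub>, j)"] by simp
    then have "(\<lambda>m. F (\<one>\<^bsub>K\<^esub>, m)) \<in> hom integer_group H"
      using HomD(1)[OF that(1)] by (simp add: hom_def)
    from hom_int_pow[OF this, of 1 m] have "F (\<one>\<^bsub>K\<^esub>, m) = F (\<one>\<^bsub>K\<^esub>, 1) [^]\<^bsub>H\<^esub> m"
      by (simp add: assms)
    then show ?thesis
      using HomD(2)[OF that(1), of "(k, 0)" "(\<one>\<^bsub>K\<^esub>, m)"] that(2) by simp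
  qed
  show ?thesis
  proof (rule bij_betw_byWitness[where
        f' = "\<lambda>(h, f). \<lambda>(k, m)\<in>carrier (K \<times>\<times> integer_group). f k \<otimes>\<^bsub>H\<^esub> h [^]\<^bsub>H\<^esub> m"])
    let ?g = "\<lambda>(h, f). \<lambda>(k, m)\<in>carrier (K \<times>\<times> integer_group). f k \<otimes>\<^bsub>H\<^esub> h [^]\<^bsub>H\<^esub> (m::int)"
    show "\<forall>F\<in>?X. ?g (?f F) = F"
    proof
      fix F assume X: "F \<in> ?X"
      show "?g (?f F) = F"
        using HomD(3)[OF X] by (auto simp: fun_eq_iff extensional_def simp flip: F[OF X])
    qed
    have one: "f \<one>\<^bsub>K\<^esub> = \<one>\<^bsub>H\<^esub>" if "f \<in> Hom K H" for f
      using that hom_one[OF _ assms, of f] by (simp add: Hom_def)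
    show "\<forall>p\<in>?Y. ?f (?g p) = p"
    proof
      fix p assume "p \<in> ?Y"
      then obtain h f where p: "p = (h, f)" and hf: "h \<in> carrier H"
        "f \<in> invariants (Hom K H) (\<lambda>h. restrict (conj_action K H h) (Hom K H)) h"
        by blast
      then have f: "f \<in> Hom K H"
        by (simp add: inv)
      show "?f (?g p) = p"
        unfolding p using one[OF f] HomD[OF f] hf(1) by (auto simp: fun_eq_iff extensional_def)
    qed
    show "?f ` ?X \<subseteq> ?Y"
    proof (rule image_subsetI)
      fix F assume X: "F \<in> ?X"
      note FD = HomD(1,2)[OF X]
      have comm: "F (\<one>\<^bsub>K\<^esub>, 1) \<otimes>\<^bsub>H\<^esub> F (k, 0) = F (k, 0) \<otimes>\<^bsub>H\<^esub> F (\<one>\<^bsub>K\<^esub>, 1)" if "k \<in> carrier K" for k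
        using FD(2)[of "(\<one>\<^bsub>K\<^esub>, 1)" "(k, 0)"] FD(2)[of "(k, 0)" "(\<one>\<^bsub>K\<^esub>, 1)"] that by simp
      have "F (k \<otimes>\<^bsub>K\<^esub> k', 0) = F (k, 0) \<otimes>\<^bsub>H\<^esub> F (k', 0)"
        if "k \<in> carrier K" "k' \<in> carrier K" for k k'
        using FD(2)[of "(k, 0)" "(k', 0)"] that by simp
      then have "(\<lambda>k\<in>carrier K. F (k, 0)) \<in> Hom K H"
        using FD(1) by (simp add: Hom_def hom_def)
      then show "?f F \<in> ?Y"
        using comm FD(1) by (simp add: inv)
    qed
    show "?g ` ?Y \<subseteq> ?X"
    proof (rule image_subsetI)
      fix p assume "p \<in> ?Y"
      then obtain h f where p: "p = (h, f)" and h: "h \<in> carrier H"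
        and "f \<in> invariants (Hom K H) (\<lambda>h. restrict (conj_action K H h) (Hom K H)) h"
        by blast
      then have f: "f \<in> Hom K H" and comm: "\<And>k. k \<in> carrier K \<Longrightarrow> h \<otimes>\<^bsub>H\<^esub> f k = f k \<otimes>\<^bsub>H\<^esub> h"
        by (auto simp: inv)
      have "f (k \<otimes>\<^bsub>K\<^esub> k') \<otimes>\<^bsub>H\<^esub> h [^]\<^bsub>H\<^esub> (m + m') =
          (f k \<otimes>\<^bsub>H\<^esub> h [^]\<^bsub>H\<^esub> m) \<otimes>\<^bsub>H\<^esub> (f k' \<otimes>\<^bsub>H\<^esub> h [^]\<^bsub>H\<^esub> m')"
        if k: "k \<in> carrier K" "k' \<in> carrier K" for k k' and m m' :: int
      proof -
        have "f (k \<otimes>\<^bsub>K\<^esub> k') \<otimes>\<^bsub>H\<^esub> h [^]\<^bsub>H\<^esub> (m + m') =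
            f k \<otimes>\<^bsub>H\<^esub> (f k' \<otimes>\<^bsub>H\<^esub> h [^]\<^bsub>H\<^esub> m) \<otimes>\<^bsub>H\<^esub> h [^]\<^bsub>H\<^esub> m'"
          using k h HomD(1,2)[OF f] by (simp add: H.int_pow_mult H.m_assoc)
        also have "f k' \<otimes>\<^bsub>H\<^esub> h [^]\<^bsub>H\<^esub> m = h [^]\<^bsub>H\<^esub> m \<otimes>\<^bsub>H\<^esub> f k'"
          using H.int_pow_commute[OF comm[OF k(2)] h] HomD(1)[OF f k(2)] by simp
        finally show ?thesis
          using k h HomD(1)[OF f] by (simp add: H.m_assoc)
      qed
      then show "?g p \<in> ?X"
        unfolding p using h HomD(1)[OF f] by (auto simp: Hom_def hom_def)
    qed
  qed
qed

lemma
  assumes "group K" "group H" "finite (carrier H)" "finite (Hom K H)"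
  shows finite_Hom_times_int: "finite (Hom (K \<times>\<times> integer_group) H)"
    and card_Hom_times_int:
      "card (Hom (K \<times>\<times> integer_group) H) = card (Hom_classes K H) * order H"
proof -
  interpret group_action H "Hom K H" "\<lambda>h. restrict (conj_action K H h) (Hom K H)"
    using assms(1,2) by (rule group_action_conj_action)
  note bij = bij_betw_Hom_times_int[OF assms(1,2)]
  have fin: "finite (invariants (Hom K H) (\<lambda>h. restrict (conj_action K H h) (Hom K H)) h)" for h
    using assms(4) by (simp add: invariants_def)
  show "finite (Hom (K \<times>\<times> integer_group) H)"
    unfolding bij_betw_finite[OF bij] using assms(3) fin by (rule finite_SigmaI)
  show "card (Hom (K \<times>\<times> integer_group) H) = card (Hom_classes K H) * order H"
    using burnside[OF assms(3,4)] assms(3) fin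
    by (simp add: bij_betw_same_card[OF bij] orbits_restrict_conj_action)
qed

lemma bij_betw_Hom_int_lattice_Suc:
  obtains g where "bij_betw g (Hom (int_lattice d \<times>\<times> integer_group) H) (Hom (int_lattice (Suc d)) H)"
  using bij_betw_Hom_iso[OF _ int_lattice_Suc_iso] comm_group_int_lattice[of "Suc d"]
  by (auto simp: comm_group_def)

lemma finite_Hom_int_lattice:
  assumes "group H" "finite (carrier H)"
  shows "finite (Hom (int_lattice d) H)"
proof (induction d)
  case 0
  have "Hom (int_lattice 0) H \<subseteq> carrier (int_lattice 0) \<rightarrow>\<^sub>E carrier H"
    by (auto simp: Hom_def hom_def PiE_def)
  then show ?case
    by (rule finite_subset) (simp add: int_lattice_0 finite_PiE assms(2))
next
  case (Suc d)
  have "finite (Hom (int_lattice d \<times>\<times> integer_group) H)"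
    using comm_group_int_lattice[of d] assms Suc by (intro finite_Hom_times_int) (simp_all add: comm_group_def)
  then show ?case
    using bij_betw_finite by (metis bij_betw_Hom_int_lattice_Suc)
qed

lemma card_Hom_int_lattice_Suc:
  assumes "group H" "finite (carrier H)"
  shows "card (Hom (int_lattice (Suc d)) H) = card (Hom_classes (int_lattice d) H) * order H"
proof -
  have "card (Hom (int_lattice (Suc d)) H) = card (Hom (int_lattice d \<times>\<times> integer_group) H)"
    using bij_betw_same_card by (metis bij_betw_Hom_int_lattice_Suc)
  also have "\<dots> = card (Hom_classes (int_lattice d) H) * order H"
    using comm_group_int_lattice[of d] assms
    by (intro card_Hom_times_int finite_Hom_int_lattice) (simp_all add: comm_group_def)
  finally show ?thesis .
qed

section \<open>Actions commuting with right translations\<close>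

locale twisted_actions =
  A: comm_group A + G: group G
  for A :: "('k, 'm) monoid_scheme" and G :: "('a, 'b) monoid_scheme"
begin

definition rtrans :: "'i \<times> 'a \<Rightarrow> 'a \<Rightarrow> 'i \<times> 'a" (infixl \<open>\<odot>\<close> 70) where
  "p \<odot> g = (fst p, snd p \<otimes>\<^bsub>G\<^esub> g)"

text \<open>An action of \<open>A\<close> on \<open>I \<times> G\<close> commuting with right translations is determined by its values at
  the points \<open>(i, \<one>)\<close>; \<open>u a i\<close> is the image of \<open>(i, \<one>)\<close> under \<open>a\<close>, so that \<open>(i, x) \<mapsto> u a i \<odot> x\<close>.\<close>

definition actions :: "'i set \<Rightarrow> ('k \<Rightarrow> 'i \<Rightarrow> 'i \<times> 'a) set" where
  "actions I = {u \<in> carrier A \<rightarrow>\<^sub>E (I \<rightarrow>\<^sub>E I \<times> carrier G).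
    (\<forall>i\<in>I. u \<one>\<^bsub>A\<^esub> i = (i, \<one>\<^bsub>G\<^esub>)) \<and>
    (\<forall>a\<in>carrier A. \<forall>b\<in>carrier A. \<forall>i\<in>I. u (a \<otimes>\<^bsub>A\<^esub> b) i = u a (fst (u b i)) \<odot> snd (u b i))}"

text \<open>The maps \<open>a \<mapsto> a x\<close> for points \<open>x\<close> whose block has stabiliser \<open>L\<close>, where \<open>\<phi>\<close> describes how \<open>L\<close>
  moves \<open>x\<close> within its block.\<close>

definition orbit_maps :: "'k set \<Rightarrow> ('k \<Rightarrow> 'a) \<Rightarrow> 'i set \<Rightarrow> ('k \<Rightarrow> 'i \<times> 'a) set" where
  "orbit_maps L \<phi> I = {p \<in> carrier A \<rightarrow>\<^sub>E I \<times> carrier G.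
    (\<forall>a\<in>carrier A. \<forall>l\<in>L. p (a \<otimes>\<^bsub>A\<^esub> l) = p a \<odot> \<phi> l) \<and>
    (\<forall>a\<in>carrier A. \<forall>b\<in>carrier A. fst (p a) = fst (p b) \<longrightarrow> inv\<^bsub>A\<^esub> a \<otimes>\<^bsub>A\<^esub> b \<in> L)}"

abbreviation supp :: "('k \<Rightarrow> 'i \<times> 'a) \<Rightarrow> 'i set" where
  "supp p \<equiv> (fst \<circ> p) ` carrier A"

lemma fst_rtrans [simp]: "fst (p \<odot> g) = fst p"
  and snd_rtrans [simp]: "snd (p \<odot> g) = snd p \<otimes>\<^bsub>G\<^esub> g"
  by (simp_all add: rtrans_def)

lemma rtrans_rtrans:
  "snd p \<in> carrier G \<Longrightarrow> g \<in> carrier G \<Longrightarrow> h \<in> carrier G \<Longrightarrow> p \<odot> g \<odot> h = p \<odot> (g \<otimes>\<^bsub>G\<^esub> h)"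
  by (simp add: rtrans_def G.m_assoc)

lemma rtrans_one: "snd p \<in> carrier G \<Longrightarrow> p \<odot> \<one>\<^bsub>G\<^esub> = p"
  by (simp add: rtrans_def)

lemma rtrans_inv_snd: "snd p \<in> carrier G \<Longrightarrow> p \<odot> inv\<^bsub>G\<^esub> (snd p) = (fst p, \<one>\<^bsub>G\<^esub>)"
  by (simp add: rtrans_def)

lemma actionsD:
  assumes "u \<in> actions I"
  shows "\<And>a i. a \<in> carrier A \<Longrightarrow> i \<in> I \<Longrightarrow> fst (u a i) \<in> I"
    "\<And>a i. a \<in> carrier A \<Longrightarrow> i \<in> I \<Longrightarrow> snd (u a i) \<in> carrier G"
    "\<And>i. i \<in> I \<Longrightarrow> u \<one>\<^bsub>A\<^esub> i = (i, \<one>\<^bsub>G\<^esub>)"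
    "\<And>a b i. a \<in> carrier A \<Longrightarrow> b \<in> carrier A \<Longrightarrow> i \<in> I \<Longrightarrow>
      u (a \<otimes>\<^bsub>A\<^esub> b) i = u a (fst (u b i)) \<odot> snd (u b i)"
    "u \<in> extensional (carrier A)"
    "\<And>a. a \<in> carrier A \<Longrightarrow> u a \<in> extensional I"
  using assms unfolding actions_def PiE_iff mem_Times_iff by blast+

lemma actionsI:
  assumes "\<And>a i. a \<in> carrier A \<Longrightarrow> i \<in> I \<Longrightarrow> fst (u a i) \<in> I \<and> snd (u a i) \<in> carrier G"
    "\<And>i. i \<in> I \<Longrightarrow> u \<one>\<^bsub>A\<^esub> i = (i, \<one>\<^bsub>G\<^esub>)"
    "\<And>a b i. a \<in> carrier A \<Longrightarrow> b \<in> carrier A \<Longrightarrow> i \<in> I \<Longrightarrow>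
      u (a \<otimes>\<^bsub>A\<^esub> b) i = u a (fst (u b i)) \<odot> snd (u b i)"
    "u \<in> extensional (carrier A)"
    "\<And>a. a \<in> carrier A \<Longrightarrow> u a \<in> extensional I"
  shows "u \<in> actions I"
  using assms unfolding actions_def PiE_iff mem_Times_iff by blast

lemma actions_ext:
  assumes "u \<in> actions I" "v \<in> actions I"
    "\<And>a i. a \<in> carrier A \<Longrightarrow> i \<in> I \<Longrightarrow> u a i = v a i"
  shows "u = v"
  using assms by (metis actionsD(5,6) extensionalityI)

lemma orbit_mapsD:
  assumes "p \<in> orbit_maps L \<phi> I"
  shows "\<And>a. a \<in> carrier A \<Longrightarrow> fst (p a) \<in> I"
    "\<And>a. a \<in> carrier A \<Longrightarrow> snd (p a) \<in> carrier G"
    "\<And>a l. a \<in> carrier A \<Longrightarrow> l \<in> L \<Longrightarrow> p (a \<otimes>\<^bsub>A\<^esub> l) = p a \<odot> \<phi> l"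
    "\<And>a b. a \<in> carrier A \<Longrightarrow> b \<in> carrier A \<Longrightarrow> fst (p a) = fst (p b) \<Longrightarrow> inv\<^bsub>A\<^esub> a \<otimes>\<^bsub>A\<^esub> b \<in> L"
    "p \<in> extensional (carrier A)"
  using assms unfolding orbit_maps_def PiE_iff mem_Times_iff by blast+

lemma orbit_mapsI:
  assumes "\<And>a. a \<in> carrier A \<Longrightarrow> fst (p a) \<in> I \<and> snd (p a) \<in> carrier G"
    "\<And>a l. a \<in> carrier A \<Longrightarrow> l \<in> L \<Longrightarrow> p (a \<otimes>\<^bsub>A\<^esub> l) = p a \<odot> \<phi> l"
    "\<And>a b. a \<in> carrier A \<Longrightarrow> b \<in> carrier A \<Longrightarrow> fst (p a) = fst (p b) \<Longrightarrow> inv\<^bsub>A\<^esub> a \<otimes>\<^bsub>A\<^esub> b \<in> L"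
    "p \<in> extensional (carrier A)"
  shows "p \<in> orbit_maps L \<phi> I"
  using assms unfolding orbit_maps_def PiE_iff mem_Times_iff by blast

section \<open>Splitting off the orbit of a point and gluing it back\<close>

definition point_orbit :: "('k \<Rightarrow> 'i \<Rightarrow> 'i \<times> 'a) \<Rightarrow> 'i \<times> 'a \<Rightarrow> 'k \<Rightarrow> 'i \<times> 'a" where
  "point_orbit u x = (\<lambda>a\<in>carrier A. u a (fst x) \<odot> snd x)"

definition stab_of :: "('k \<Rightarrow> 'i \<times> 'a) \<Rightarrow> 'k set" where
  "stab_of p = {l \<in> carrier A. fst (p l) = fst (p \<one>\<^bsub>A\<^esub>)}"

text \<open>An element l of the stabiliser moves the base point x = p 1 within its block, to
  \<open>x \<odot> g\<close> for exactly one g; this g is the value at l.\<close>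

definition holonomy :: "('k \<Rightarrow> 'i \<times> 'a) \<Rightarrow> 'k \<Rightarrow> 'a" where
  "holonomy p = (\<lambda>l\<in>stab_of p. inv\<^bsub>G\<^esub> (snd (p \<one>\<^bsub>A\<^esub>)) \<otimes>\<^bsub>G\<^esub> snd (p l))"

definition restrict_action :: "('k \<Rightarrow> 'i \<Rightarrow> 'i \<times> 'a) \<Rightarrow> 'i set \<Rightarrow> 'k \<Rightarrow> 'i \<Rightarrow> 'i \<times> 'a" where
  "restrict_action u J = (\<lambda>a\<in>carrier A. restrict (u a) J)"

text \<open>If block i contains p b, then (i, 1) is p b translated by the inverse of
  \<open>snd (p b)\<close>, and a must take it to p (a b) translated likewise. Independence of the
  chosen b is \<open>glue_on_orbit\<close>.\<close>

definition glue :: "'i set \<Rightarrow> ('k \<Rightarrow> 'i \<times> 'a) \<Rightarrow> ('k \<Rightarrow> 'i \<Rightarrow> 'i \<times> 'a) \<Rightarrow> 'k \<Rightarrow> 'i \<Rightarrow> 'i \<times> 'a" where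
  "glue I p u = (\<lambda>a\<in>carrier A. \<lambda>i\<in>I. if i \<in> supp p
     then let b = (SOME b. b \<in> carrier A \<and> fst (p b) = i) in p (a \<otimes>\<^bsub>A\<^esub> b) \<odot> inv\<^bsub>G\<^esub> (snd (p b))
     else u a i)"

lemma point_orbit_mult:
  assumes "u \<in> actions I" "x \<in> I \<times> carrier G" "a \<in> carrier A" "b \<in> carrier A"
  shows "point_orbit u x (a \<otimes>\<^bsub>A\<^esub> b) = u a (fst (point_orbit u x b)) \<odot> snd (point_orbit u x b)"
  using assms actionsD(1,2,4)[OF assms(1)]
  by (auto simp: point_orbit_def rtrans_rtrans mem_Times_iff)

lemma point_orbit_one:
  assumes "u \<in> actions I" "x \<in> I \<times> carrier G"
  shows "point_orbit u x \<one>\<^bsub>A\<^esub> = x"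
  using assms actionsD(3)[OF assms(1)] by (auto simp: point_orbit_def rtrans_def mem_Times_iff)

lemma point_orbit_closed:
  assumes "u \<in> actions I" "x \<in> I \<times> carrier G" "a \<in> carrier A"
  shows "fst (point_orbit u x a) \<in> I" "snd (point_orbit u x a) \<in> carrier G"
  using assms actionsD(1,2)[OF assms(1)] by (auto simp: point_orbit_def mem_Times_iff)

lemma action_inverse:
  assumes "u \<in> actions I" "a \<in> carrier A" "i \<in> I"
  shows "fst (u (inv\<^bsub>A\<^esub> a) (fst (u a i))) = i"
proof -
  have "u (inv\<^bsub>A\<^esub> a) (fst (u a i)) \<odot> snd (u a i) = (i, \<one>\<^bsub>G\<^esub>)"
    using actionsD(3,4)[OF assms(1)] assms by (metis A.inv_closed A.l_inv)
  then show ?thesis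
    by (metis fst_conv fst_rtrans)
qed

text \<open>For l in the stabiliser, l x = x g with g its holonomy. Actions commute with right
  translations, so (a l) x = (a x) g for every a; with a in the stabiliser too, this makes the
  holonomy multiplicative. If a x and b x lie in one block, a^(-1) b fixes the block of x.\<close>

lemma stab_of_point_orbit:
  assumes u: "u \<in> actions I" and x: "x \<in> I \<times> carrier G"
  defines "p \<equiv> point_orbit u x"
  shows subgroup_stab_of: "subgroup (stab_of p) A"
    and holonomy_hom: "holonomy p \<in> Hom (A\<lparr>carrier := stab_of p\<rparr>) G"
    and point_orbit_in_orbit_maps: "p \<in> orbit_maps (stab_of p) (holonomy p) I"
proof -
  note mult = point_orbit_mult[OF u x, folded p_def]
  note one = point_orbit_one[OF u x, folded p_def]
  note closed = point_orbit_closed[OF u x, folded p_def]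
  have inj: "inv\<^bsub>A\<^esub> a \<otimes>\<^bsub>A\<^esub> b \<in> stab_of p"
    if "a \<in> carrier A" "b \<in> carrier A" "fst (p a) = fst (p b)" for a b
  proof -
    have "fst (p (inv\<^bsub>A\<^esub> a \<otimes>\<^bsub>A\<^esub> b)) = fst (u (inv\<^bsub>A\<^esub> a) (fst (p a)))"
      using that by (simp add: mult)
    also have "\<dots> = fst x"
      using that(1) x action_inverse[OF u that(1), of "fst x"]
      by (simp add: p_def point_orbit_def mem_Times_iff)
    finally show ?thesis
      using that by (simp add: stab_of_def one)
  qed
  show sub: "subgroup (stab_of p) A"
  proof (rule A.subgroupI)
    show "stab_of p \<subseteq> carrier A" "stab_of p \<noteq> {}"
      by (auto simp: stab_of_def)
    show "inv\<^bsub>A\<^esub> a \<in> stab_of p" if "a \<in> stab_of p" for a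
      using that inj[of a "\<one>\<^bsub>A\<^esub>"] by (simp add: stab_of_def)
    show "a \<otimes>\<^bsub>A\<^esub> b \<in> stab_of p" if "a \<in> stab_of p" "b \<in> stab_of p" for a b
    proof -
      from that have ab: "a \<in> carrier A" "b \<in> carrier A" "fst (p b) = fst (p \<one>\<^bsub>A\<^esub>)"
          "fst (p a) = fst (p \<one>\<^bsub>A\<^esub>)"
        by (auto simp: stab_of_def)
      then have "fst (p (a \<otimes>\<^bsub>A\<^esub> b)) = fst (p (a \<otimes>\<^bsub>A\<^esub> \<one>\<^bsub>A\<^esub>))"
        by (simp only: mult A.one_closed fst_rtrans)
      with ab show ?thesis
        by (simp add: stab_of_def)
    qed
  qed
  have hc: "holonomy p l \<in> carrier G" if "l \<in> stab_of p" for l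
    using that closed(2) by (simp add: holonomy_def stab_of_def)
  have shift: "p (a \<otimes>\<^bsub>A\<^esub> l) = p a \<odot> holonomy p l" if "a \<in> carrier A" "l \<in> stab_of p" for a l
  proof -
    from that have l: "l \<in> carrier A" "fst (p l) = fst (p \<one>\<^bsub>A\<^esub>)"
      by (auto simp: stab_of_def)
    have "p a = u a (fst (p \<one>\<^bsub>A\<^esub>)) \<odot> snd (p \<one>\<^bsub>A\<^esub>)"
      using mult[OF that(1) A.one_closed] that(1) by simp
    then have "p a \<odot> holonomy p l = u a (fst (p \<one>\<^bsub>A\<^esub>)) \<odot> (snd (p \<one>\<^bsub>A\<^esub>) \<otimes>\<^bsub>G\<^esub> holonomy p l)"
      using hc[OF that(2)] closed(1,2) that(1) actionsD(2)[OF u] by (simp add: rtrans_rtrans)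
    also have "snd (p \<one>\<^bsub>A\<^esub>) \<otimes>\<^bsub>G\<^esub> holonomy p l = snd (p l)"
      using that l closed(2) by (simp add: holonomy_def G.m_assoc[symmetric])
    finally show ?thesis
      using l that by (simp add: mult)
  qed
  have "holonomy p (l \<otimes>\<^bsub>A\<^esub> l') = holonomy p l \<otimes>\<^bsub>G\<^esub> holonomy p l'"
    if "l \<in> stab_of p" "l' \<in> stab_of p" for l l'
  proof -
    have "l \<in> carrier A" "l \<otimes>\<^bsub>A\<^esub> l' \<in> stab_of p"
      using that subgroup.m_closed[OF sub] subgroup.mem_carrier[OF sub] by auto
    then show ?thesis
      using that closed(2) shift[of l l'] hc[of l']
      by (simp add: holonomy_def[of p] G.m_assoc)
  qed
  with hc show "holonomy p \<in> Hom (A\<lparr>carrier := stab_of p\<rparr>) G"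
    by (auto simp: Hom_def hom_def holonomy_def)
  show "p \<in> orbit_maps (stab_of p) (holonomy p) I"
    using closed shift inj by (intro orbit_mapsI) (auto simp: p_def point_orbit_def)
qed

text \<open>The complement of an orbit is stable: if a took j into the orbit, then a^(-1) would show
  that j lies in it already.\<close>

lemma restrict_action_in_actions:
  assumes u: "u \<in> actions I" and x: "x \<in> I \<times> carrier G"
  defines "J \<equiv> I - supp (point_orbit u x)"
  shows "restrict_action u J \<in> actions J"
proof -
  let ?p = "point_orbit u x"
  have inJ: "fst (u a j) \<in> J" if "a \<in> carrier A" "j \<in> J" for a j
  proof -
    have "fst (u a j) \<notin> supp ?p"
    proof
      assume "fst (u a j) \<in> supp ?p"
      then obtain b where b: "b \<in> carrier A" "fst (u a j) = fst (?p b)"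
        by auto
      have "fst (?p (inv\<^bsub>A\<^esub> a \<otimes>\<^bsub>A\<^esub> b)) = fst (u (inv\<^bsub>A\<^esub> a) (fst (u a j)))"
        using b that by (simp add: point_orbit_mult[OF u x])
      also have "\<dots> = j"
        using that by (intro action_inverse[OF u]) (auto simp: J_def)
      finally have "j \<in> supp ?p"
        using that b by (intro image_eqI[of _ _ "inv\<^bsub>A\<^esub> a \<otimes>\<^bsub>A\<^esub> b"]) auto
      with that show False
        by (simp add: J_def)
    qed
    with that actionsD(1)[OF u, of a j] show ?thesis
      by (simp add: J_def)
  qed
  have JI: "j \<in> I" if "j \<in> J" for j
    using that by (simp add: J_def)
  show ?thesis
    using inJ JI actionsD(2,3,4)[OF u]
    by (intro actionsI) (auto simp: restrict_action_def)
qed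

text \<open>Two elements b, b' over the same block differ by some l in L, and
  \<open>\<phi> l\<close> enters both p (a b) and \<open>snd (p b)\<close>, where it
  cancels.\<close>

lemma glue_on_orbit:
  assumes "subgroup L A" "\<phi> \<in> Hom (A\<lparr>carrier := L\<rparr>) G" and p: "p \<in> orbit_maps L \<phi> I"
    and "a \<in> carrier A" "b \<in> carrier A"
  shows "glue I p u a (fst (p b)) = p (a \<otimes>\<^bsub>A\<^esub> b) \<odot> inv\<^bsub>G\<^esub> (snd (p b))"
proof -
  note pD = orbit_mapsD[OF p]
  define b' where "b' = (SOME b'. b' \<in> carrier A \<and> fst (p b') = fst (p b))"
  have b': "b' \<in> carrier A" "fst (p b') = fst (p b)"
    using someI[of "\<lambda>b'. b' \<in> carrier A \<and> fst (p b') = fst (p b)" b] assms(5)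
    by (auto simp: b'_def)
  define l where "l = inv\<^bsub>A\<^esub> b' \<otimes>\<^bsub>A\<^esub> b"
  have l: "l \<in> L" "b = b' \<otimes>\<^bsub>A\<^esub> l" "\<phi> l \<in> carrier G" "l \<in> carrier A"
    using pD(4)[of b' b] b' assms(1,2,5) HomD(1)[OF assms(2), of l] subgroup.mem_carrier[OF assms(1)]
    by (auto simp: l_def A.m_assoc[symmetric])
  have "a \<otimes>\<^bsub>A\<^esub> b = (a \<otimes>\<^bsub>A\<^esub> b') \<otimes>\<^bsub>A\<^esub> l"
    using l b' assms(4) by (simp add: A.m_assoc)
  then have "p (a \<otimes>\<^bsub>A\<^esub> b) \<odot> inv\<^bsub>G\<^esub> (snd (p b)) =
      p (a \<otimes>\<^bsub>A\<^esub> b') \<odot> \<phi> l \<odot> inv\<^bsub>G\<^esub> (snd (p b') \<otimes>\<^bsub>G\<^esub> \<phi> l)"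
    using pD(3)[of b' l] pD(3)[of "a \<otimes>\<^bsub>A\<^esub> b'" l] l b' assms(4) by simp
  also have "\<dots> = p (a \<otimes>\<^bsub>A\<^esub> b') \<odot> inv\<^bsub>G\<^esub> (snd (p b'))"
    using pD(2) b' assms(4) l
    by (simp add: rtrans_rtrans G.inv_mult_group G.m_assoc[symmetric])
  also have "\<dots> = glue I p u a (fst (p b))"
    using assms(4,5) pD(1) by (simp add: glue_def b'_def Let_def)
  finally show ?thesis ..
qed

lemma glue_off_orbit:
  assumes "a \<in> carrier A" "j \<in> I - supp p"
  shows "glue I p u a j = u a j"
  using assms by (simp add: glue_def)

lemma glue_in_actions:
  assumes L: "subgroup L A" "\<phi> \<in> Hom (A\<lparr>carrier := L\<rparr>) G" and p: "p \<in> orbit_maps L \<phi> I"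
    and u: "u \<in> actions (I - supp p)"
  shows "glue I p u \<in> actions I"
proof (rule actionsI)
  note pD = orbit_mapsD[OF p]
  note on = glue_on_orbit[OF L p]
  note off = glue_off_orbit[of _ _ I p u]
  fix a i assume a: "a \<in> carrier A" and i: "i \<in> I"
  show "fst (glue I p u a i) \<in> I \<and> snd (glue I p u a i) \<in> carrier G"
  proof (cases "i \<in> supp p")
    case True
    then show ?thesis
      using a pD(1,2) by (auto simp: on)
  next
    case False
    then show ?thesis
      using a i actionsD(1,2)[OF u a, of i] by (simp add: off)
  qed
next
  note pD = orbit_mapsD[OF p]
  note on = glue_on_orbit[OF L p]
  note off = glue_off_orbit[of _ _ I p u]
  fix i assume i: "i \<in> I"
  show "glue I p u \<one>\<^bsub>A\<^esub> i = (i, \<one>\<^bsub>G\<^esub>)"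
  proof (cases "i \<in> supp p")
    case True
    then show ?thesis
      using pD(2) by (auto simp: on rtrans_inv_snd)
  next
    case False
    then show ?thesis
      using i actionsD(3)[OF u, of i] by (simp add: off)
  qed
next
  note pD = orbit_mapsD[OF p]
  note on = glue_on_orbit[OF L p]
  note off = glue_off_orbit[of _ _ I p u]
  fix a c i assume ac: "a \<in> carrier A" "c \<in> carrier A" and i: "i \<in> I"
  show "glue I p u (a \<otimes>\<^bsub>A\<^esub> c) i = glue I p u a (fst (glue I p u c i)) \<odot> snd (glue I p u c i)"
  proof (cases "i \<in> supp p")
    case True
    then obtain b where b: "b \<in> carrier A" "i = fst (p b)"
      by auto
    \<comment> \<open>Acting by c and then by a brings \<open>snd\<close> of p (c b) and its inverse
      side by side.\<close>
    have "p (a \<otimes>\<^bsub>A\<^esub> (c \<otimes>\<^bsub>A\<^esub> b)) \<odot> inv\<^bsub>G\<^esub> (snd (p (c \<otimes>\<^bsub>A\<^esub> b))) \<odot> (snd (p (c \<otimes>\<^bsub>A\<^esub> b)) \<otimes>\<^bsub>G\<^esub> inv\<^bsub>G\<^esub> (snd (p b)))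
        = p (a \<otimes>\<^bsub>A\<^esub> (c \<otimes>\<^bsub>A\<^esub> b)) \<odot> inv\<^bsub>G\<^esub> (snd (p b))"
      using ac b pD(2) by (simp add: rtrans_rtrans G.m_assoc[symmetric])
    then show ?thesis
      using ac b by (simp add: on A.m_assoc)
  next
    case False
    with i have iJ: "i \<in> I - supp p" by simp
    then show ?thesis
      using ac actionsD(1)[OF u ac(2) iJ] actionsD(4)[OF u ac iJ] by (simp add: off)
  qed
qed (auto simp: glue_def)

text \<open>The inverse map may forget L and \<open>\<phi>\<close>, since p determines them as its
  stabiliser and holonomy; the base point is recovered as p 1.\<close>

lemma bij_betw_actions:
  "bij_betw (\<lambda>(u, x). let p = point_orbit u x in
      ((stab_of p, holonomy p), p, restrict_action u (I - supp p)))
    (actions I \<times> (I \<times> carrier G))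
    (SIGMA (L, \<phi>):(SIGMA L:{L. subgroup L A}. Hom (A\<lparr>carrier := L\<rparr>) G).
      SIGMA p:orbit_maps L \<phi> I. actions (I - supp p))"
    (is "bij_betw ?f ?X ?Y")
proof (rule bij_betw_byWitness[where f' = "\<lambda>(_, p, u). (glue I p u, p \<one>\<^bsub>A\<^esub>)"])
  show "?f ` ?X \<subseteq> ?Y"
  proof (rule image_subsetI)
    fix z assume "z \<in> ?X"
    then obtain u x where z: "z = (u, x)" "u \<in> actions I" "x \<in> I \<times> carrier G"
      by blast
    show "?f z \<in> ?Y"
      using subgroup_stab_of[OF z(2,3)] holonomy_hom[OF z(2,3)]
        point_orbit_in_orbit_maps[OF z(2,3)] restrict_action_in_actions[OF z(2,3)]
      by (simp add: z(1) Let_def)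
  qed
  show "(\<lambda>(_, p, u). (glue I p u, p \<one>\<^bsub>A\<^esub>)) ` ?Y \<subseteq> ?X"
  proof (rule image_subsetI)
    fix z assume "z \<in> ?Y"
    then obtain L \<phi> p u where z: "z = ((L, \<phi>), p, u)" and L: "subgroup L A"
      "\<phi> \<in> Hom (A\<lparr>carrier := L\<rparr>) G" and p: "p \<in> orbit_maps L \<phi> I" and u: "u \<in> actions (I - supp p)"
      by auto
    show "(\<lambda>(_, p, u). (glue I p u, p \<one>\<^bsub>A\<^esub>)) z \<in> ?X"
      using glue_in_actions[OF L p u] orbit_mapsD(1,2)[OF p A.one_closed]
      by (simp add: z mem_Times_iff)
  qed
  show "\<forall>z\<in>?X. (\<lambda>(_, p, u). (glue I p u, p \<one>\<^bsub>A\<^esub>)) (?f z) = z"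
  proof
    fix z assume "z \<in> ?X"
    then obtain u x where z: "z = (u, x)" "u \<in> actions I" "x \<in> I \<times> carrier G"
      by blast
    let ?p = "point_orbit u x"
    let ?u = "glue I ?p (restrict_action u (I - supp ?p))"
    note L = subgroup_stab_of[OF z(2,3)] holonomy_hom[OF z(2,3)] point_orbit_in_orbit_maps[OF z(2,3)]
    have "?u = u"
    proof (rule actions_ext[OF glue_in_actions[OF L restrict_action_in_actions[OF z(2,3)]] z(2)])
      fix a i assume ai: "a \<in> carrier A" "i \<in> I"
      show "?u a i = u a i"
      proof (cases "i \<in> supp ?p")
        case True
        then obtain b where b: "b \<in> carrier A" "i = fst (?p b)"
          by auto
        have "?u a i = u a i \<odot> snd (?p b) \<odot> inv\<^bsub>G\<^esub> (snd (?p b))"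
          using ai b glue_on_orbit[OF L ai(1) b(1)] by (simp add: point_orbit_mult[OF z(2,3)])
        also have "\<dots> = u a i"
          using actionsD(2)[OF z(2) ai] point_orbit_closed[OF z(2,3) b(1)]
          by (simp add: rtrans_rtrans rtrans_one)
        finally show ?thesis .
      next
        case False
        with ai show ?thesis
          by (simp add: glue_off_orbit restrict_action_def)
      qed
    qed
    with z show "(\<lambda>(_, p, u). (glue I p u, p \<one>\<^bsub>A\<^esub>)) (?f z) = z"
      by (simp add: Let_def point_orbit_one)
  qed
  show "\<forall>z\<in>?Y. ?f ((\<lambda>(_, p, u). (glue I p u, p \<one>\<^bsub>A\<^esub>)) z) = z"
  proof
    fix z assume "z \<in> ?Y"
    then obtain L \<phi> p u where z: "z = ((L, \<phi>), p, u)" and L: "subgroup L A"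
      "\<phi> \<in> Hom (A\<lparr>carrier := L\<rparr>) G" and p: "p \<in> orbit_maps L \<phi> I" and u: "u \<in> actions (I - supp p)"
      by auto
    note pD = orbit_mapsD[OF p]
    have 1: "point_orbit (glue I p u) (p \<one>\<^bsub>A\<^esub>) = p"
    proof (rule extensionalityI[of _ "carrier A"])
      fix a assume a: "a \<in> carrier A"
      show "point_orbit (glue I p u) (p \<one>\<^bsub>A\<^esub>) a = p a"
        using a pD(2) by (simp add: point_orbit_def glue_on_orbit[OF L p] rtrans_rtrans rtrans_one)
    qed (use pD(5) in \<open>simp_all add: point_orbit_def\<close>)
    have pl: "p l = p \<one>\<^bsub>A\<^esub> \<odot> \<phi> l" if "l \<in> L" for l
      using pD(3)[OF A.one_closed that] subgroup.mem_carrier[OF L(1) that] by simp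
    have 2: "stab_of p = L"
    proof (intro equalityI subsetI)
      fix l assume "l \<in> stab_of p"
      then show "l \<in> L"
        using pD(4)[of "\<one>\<^bsub>A\<^esub>" l] by (simp add: stab_of_def)
    next
      fix l assume "l \<in> L"
      then show "l \<in> stab_of p"
        using arg_cong[OF pl, of l fst] subgroup.mem_carrier[OF L(1)] by (simp add: stab_of_def)
    qed
    have 3: "holonomy p = \<phi>"
    proof (rule extensionalityI[of _ L])
      fix l assume l: "l \<in> L"
      then have "snd (p l) = snd (p \<one>\<^bsub>A\<^esub>) \<otimes>\<^bsub>G\<^esub> \<phi> l"
        by (subst pl) simp_all
      then show "holonomy p l = \<phi> l"
        using HomD(1)[OF L(2), of l] l pD(2)[of "\<one>\<^bsub>A\<^esub>"]
        by (simp add: holonomy_def 2 G.m_assoc[symmetric])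
    qed (use HomD(3)[OF L(2)] in \<open>simp_all add: holonomy_def 2\<close>)
    have 4: "restrict_action (glue I p u) (I - supp p) = u"
      using actionsD(5,6)[OF u]
      by (auto simp: restrict_action_def glue_off_orbit fun_eq_iff extensional_def)
    show "?f ((\<lambda>(_, p, u). (glue I p u, p \<one>\<^bsub>A\<^esub>)) z) = z"
      unfolding z by (simp only: Let_def prod.case 1 2 3 4)
  qed
qed

section \<open>Counting orbit maps\<close>

lemma card_supp_orbit_map:
  assumes "subgroup L A" "\<phi> \<in> Hom (A\<lparr>carrier := L\<rparr>) G" "p \<in> orbit_maps L \<phi> I"
  shows "card (supp p) = card (rcosets\<^bsub>A\<^esub> L)"
proof -
  note pD = orbit_mapsD[OF assms(3)]
  \<comment> \<open>Orbit maps separate blocks by a^(-1) b, right cosets by a b^(-1); commutativity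
    of A matches the two.\<close>
  have "(fst \<circ> p) a = (fst \<circ> p) b \<longleftrightarrow> a \<otimes>\<^bsub>A\<^esub> inv\<^bsub>A\<^esub> b \<in> L" if "a \<in> carrier A" "b \<in> carrier A" for a b
  proof
    assume "(fst \<circ> p) a = (fst \<circ> p) b"
    then show "a \<otimes>\<^bsub>A\<^esub> inv\<^bsub>A\<^esub> b \<in> L"
      using pD(4)[of b a] that by (simp add: A.m_comm)
  next
    assume "a \<otimes>\<^bsub>A\<^esub> inv\<^bsub>A\<^esub> b \<in> L"
    moreover have "b \<otimes>\<^bsub>A\<^esub> (a \<otimes>\<^bsub>A\<^esub> inv\<^bsub>A\<^esub> b) = a"
      using that by (simp add: A.m_lcomm)
    ultimately show "(fst \<circ> p) a = (fst \<circ> p) b"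
      using pD(3)[of b "a \<otimes>\<^bsub>A\<^esub> inv\<^bsub>A\<^esub> b"] that by simp
  qed
  then show ?thesis
    by (rule A.card_rcosets_eq[OF assms(1), symmetric])
qed

text \<open>The values at one representative of each coset are arbitrary apart from lying in
  distinct blocks, and equivariance under L forces all others.\<close>

lemma bij_betw_orbit_maps:
  assumes L: "subgroup L A" and \<phi>: "\<phi> \<in> Hom (A\<lparr>carrier := L\<rparr>) G"
  defines "t \<equiv> \<lambda>C. SOME a. a \<in> C"
  shows "bij_betw (\<lambda>p. (\<lambda>C\<in>rcosets\<^bsub>A\<^esub> L. fst (p (t C)), \<lambda>C\<in>rcosets\<^bsub>A\<^esub> L. snd (p (t C))))
    (orbit_maps L \<phi> I)
    ({f \<in> rcosets\<^bsub>A\<^esub> L \<rightarrow>\<^sub>E I. inj_on f (rcosets\<^bsub>A\<^esub> L)} \<times> (rcosets\<^bsub>A\<^esub> L \<rightarrow>\<^sub>E carrier G))"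
    (is "bij_betw ?f ?X ?Y")
proof -
  let ?R = "rcosets\<^bsub>A\<^esub> L"
  let ?c = "\<lambda>a. L #>\<^bsub>A\<^esub> a"
  note HD = HomD(1,2)[OF \<phi>, simplified]
  have t: "t C \<in> carrier A \<and> ?c (t C) = C" if "C \<in> ?R" for C
  proof -
    from that obtain a where a: "a \<in> carrier A" "C = ?c a"
      by (auto simp: RCOSETS_def)
    have "t C \<in> C"
      unfolding t_def using A.rcos_self[OF a(1) L] a by (metis someI)
    with a L show ?thesis
      by (metis A.is_group A.repr_independence subgroup.elemrcos_carrier)
  qed
  have cR: "?c a \<in> ?R" if "a \<in> carrier A" for a
    using that L by (simp add: A.rcosetsI subgroup.subset)
  have c_eq: "?c a = ?c b \<longleftrightarrow> inv\<^bsub>A\<^esub> a \<otimes>\<^bsub>A\<^esub> b \<in> L" if "a \<in> carrier A" "b \<in> carrier A" for a b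
    using that A.rcos_eq_iff[OF L, of b a] by (auto simp: A.m_comm)
  \<comment> \<open>The L-part of a relative to the chosen representative of its coset.\<close>
  define s where "s a = inv\<^bsub>A\<^esub> (t (?c a)) \<otimes>\<^bsub>A\<^esub> a" for a
  have sL: "s a \<in> L" and st: "t (?c a) \<otimes>\<^bsub>A\<^esub> s a = a" if "a \<in> carrier A" for a
    using that t[OF cR[OF that]] c_eq[of "t (?c a)" a] by (auto simp: s_def A.m_assoc[symmetric])
  have cl: "?c (a \<otimes>\<^bsub>A\<^esub> l) = ?c a" if "a \<in> carrier A" "l \<in> L" for a l
    using that L subgroup.mem_carrier[OF L]
    by (subst c_eq) (simp_all add: A.inv_mult_group A.m_assoc subgroup.m_inv_closed)
  have sl: "s (a \<otimes>\<^bsub>A\<^esub> l) = s a \<otimes>\<^bsub>A\<^esub> l" if "a \<in> carrier A" "l \<in> L" for a l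
    using that t[OF cR[OF that(1)]] subgroup.mem_carrier[OF L that(2)]
    by (simp add: s_def cl A.m_assoc)
  let ?g = "\<lambda>(f, h). \<lambda>a\<in>carrier A. (f (?c a), h (?c a) \<otimes>\<^bsub>G\<^esub> \<phi> (s a))"
  show ?thesis
  proof (rule bij_betw_byWitness[where f' = ?g])
    show "?f ` ?X \<subseteq> ?Y"
    proof (rule image_subsetI)
      fix p assume p: "p \<in> ?X"
      note pD = orbit_mapsD[OF p]
      have "C = C'" if "C \<in> ?R" "C' \<in> ?R" "fst (p (t C)) = fst (p (t C'))" for C C'
        using pD(4)[of "t C" "t C'"] t[OF that(1)] t[OF that(2)] that c_eq[of "t C" "t C'"] by auto
      then show "?f p \<in> ?Y"
        using pD(1,2) t by (auto simp: inj_on_def)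
    qed
    show "?g ` ?Y \<subseteq> ?X"
    proof (rule image_subsetI)
      fix z assume "z \<in> ?Y"
      then obtain f h where z: "z = (f, h)" "f \<in> ?R \<rightarrow>\<^sub>E I" "inj_on f ?R" "h \<in> ?R \<rightarrow>\<^sub>E carrier G"
        by blast
      have fh: "f (?c a) \<in> I" "h (?c a) \<in> carrier G" if "a \<in> carrier A" for a
        using z cR[OF that] by auto
      show "?g z \<in> ?X"
      proof (rule orbit_mapsI)
        fix a l assume a: "a \<in> carrier A" "l \<in> L"
        then show "?g z (a \<otimes>\<^bsub>A\<^esub> l) = ?g z a \<odot> \<phi> l"
          using fh(2)[OF a(1)] HD sL[OF a(1)] subgroup.mem_carrier[OF L a(2)]
          by (simp add: z cl sl rtrans_def G.m_assoc)
      next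
        fix a b assume ab: "a \<in> carrier A" "b \<in> carrier A" "fst (?g z a) = fst (?g z b)"
        then have "?c a = ?c b"
          using z(3) cR by (auto simp: z(1) inj_on_def)
        with ab c_eq show "inv\<^bsub>A\<^esub> a \<otimes>\<^bsub>A\<^esub> b \<in> L"
          by blast
      qed (use fh HD sL in \<open>auto simp: z(1)\<close>)
    qed
    show "\<forall>p\<in>?X. ?g (?f p) = p"
    proof
      fix p assume p: "p \<in> ?X"
      note pD = orbit_mapsD[OF p]
      have "(fst (p (t (?c a))), snd (p (t (?c a))) \<otimes>\<^bsub>G\<^esub> \<phi> (s a)) = p a" if "a \<in> carrier A" for a
        using pD(3)[of "t (?c a)" "s a"] t[OF cR[OF that]] sL[OF that] st[OF that]
        by (simp add: rtrans_def)
      with pD(5) cR show "?g (?f p) = p"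
        by (auto simp: fun_eq_iff extensional_def)
    qed
    \<comment> \<open>A chosen representative has trivial L-part, so the twist by
      \<open>\<phi>\<close> disappears there.\<close>
    have s_one: "\<phi> (s (t C)) = \<one>\<^bsub>G\<^esub>" if "C \<in> ?R" for C
    proof -
      have "s (t C) = \<one>\<^bsub>A\<^esub>"
        using t[OF that] by (simp add: s_def)
      moreover have "\<phi> \<one>\<^bsub>A\<^esub> = \<one>\<^bsub>G\<^esub>"
        using hom_one[of \<phi> "A\<lparr>carrier := L\<rparr>" G] \<phi> subgroup.subgroup_is_group[OF L A.is_group]
        by (simp add: Hom_def G.is_group)
      ultimately show ?thesis by simp
    qed
    show "\<forall>z\<in>?Y. ?f (?g z) = z"
    proof
      fix z assume "z \<in> ?Y"
      then obtain f h where z: "z = (f, h)" "f \<in> ?R \<rightarrow>\<^sub>E I" "h \<in> ?R \<rightarrow>\<^sub>E carrier G"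
        by blast
      have "f (?c (t C)) = f C" "h (?c (t C)) \<otimes>\<^bsub>G\<^esub> \<phi> (s (t C)) = h C" "t C \<in> carrier A"
        if "C \<in> ?R" for C
        using t[OF that] s_one[OF that] PiE_mem[OF z(3) that] by auto
      with z show "?f (?g z) = z"
        by (auto simp: fun_eq_iff PiE_iff extensional_def)
    qed
  qed
qed

text \<open>Injections of the cosets into I give the falling factorial, free second components the
  power. With more cosets than blocks, the factor at i = \<open>card I\<close> is 0, as it should be
  when no injection exists.\<close>

lemma
  assumes "finite I" "finite (carrier G)" "subgroup L A" "\<phi> \<in> Hom (A\<lparr>carrier := L\<rparr>) G"
    "finite (rcosets\<^bsub>A\<^esub> L)"
  shows finite_orbit_maps: "finite (orbit_maps L \<phi> I)"
    and card_orbit_maps: "card (orbit_maps L \<phi> I) =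
      (\<Prod>i<card (rcosets\<^bsub>A\<^esub> L). card I - i) * order G ^ card (rcosets\<^bsub>A\<^esub> L)"
proof -
  note bij = bij_betw_orbit_maps[OF assms(3,4)]
  have "finite {f \<in> rcosets\<^bsub>A\<^esub> L \<rightarrow>\<^sub>E I. inj_on f (rcosets\<^bsub>A\<^esub> L)}"
    using assms by (intro finite_subset[OF _ finite_PiE]) auto
  then show "finite (orbit_maps L \<phi> I)"
    unfolding bij_betw_finite[OF bij] using assms by (auto intro!: finite_cartesian_product finite_PiE)
  show "card (orbit_maps L \<phi> I) =
      (\<Prod>i<card (rcosets\<^bsub>A\<^esub> L). card I - i) * order G ^ card (rcosets\<^bsub>A\<^esub> L)"
    using card_inj_on_subset_funcset[OF assms(5,1) subset_refl] assms(5)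
    by (simp add: bij_betw_same_card[OF bij] card_cartesian_product card_funcsetE order_def
        atLeast0LessThan)
qed

section \<open>Relabelling blocks\<close>

lemma transport_in_actions:
  assumes "bij_betw h I J" "u \<in> actions I"
  shows "(\<lambda>a\<in>carrier A. \<lambda>j\<in>J. map_prod h id (u a (inv_into I h j))) \<in> actions J"
proof -
  have h: "h i \<in> J" "inv_into I h (h i) = i" if "i \<in> I" for i
    using assms(1) that by (auto simp: bij_betw_def)
  have h': "inv_into I h j \<in> I" "h (inv_into I h j) = j" if "j \<in> J" for j
    using assms(1) that by (auto simp: bij_betw_def inv_into_into f_inv_into_f)
  show ?thesis
    using h h' actionsD[OF assms(2)]
    by (intro actionsI) (auto simp: fst_map_prod snd_map_prod rtrans_def map_prod_def case_prod_unfold)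
qed

lemma bij_betw_transport:
  assumes "bij_betw h I J"
  shows "bij_betw (\<lambda>u. \<lambda>a\<in>carrier A. \<lambda>j\<in>J. map_prod h id (u a (inv_into I h j))) (actions I) (actions J)"
proof -
  let ?k = "inv_into I h"
  have k: "bij_betw ?k J I"
    using assms by (rule bij_betw_inv_into)
  have h: "h i \<in> J" "?k (h i) = i" if "i \<in> I" for i
    using assms(1) that by (auto simp: bij_betw_def)
  have h': "?k j \<in> I" "h (?k j) = j" "inv_into J ?k (?k j) = j" if "j \<in> J" for j
    using assms(1) k that by (auto simp: bij_betw_def inv_into_into f_inv_into_f)
  have ki: "inv_into J ?k i = h i" if "i \<in> I" for i
    using h'(3)[OF h(1)[OF that]] h(2)[OF that] by simp
  show ?thesis
  proof (rule bij_betw_byWitness[where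
        f' = "\<lambda>u. \<lambda>a\<in>carrier A. \<lambda>i\<in>I. map_prod ?k id (u a (inv_into J ?k i))"])
    show "\<forall>u\<in>actions I. (\<lambda>a\<in>carrier A. \<lambda>i\<in>I. map_prod ?k id ((\<lambda>a\<in>carrier A. \<lambda>j\<in>J.
        map_prod h id (u a (?k j))) a (inv_into J ?k i))) = u"
    proof
      fix u assume u: "u \<in> actions I"
      show "(\<lambda>a\<in>carrier A. \<lambda>i\<in>I. map_prod ?k id ((\<lambda>a\<in>carrier A. \<lambda>j\<in>J.
        map_prod h id (u a (?k j))) a (inv_into J ?k i))) = u"
        using actionsD(1,5,6)[OF u] h
        by (auto simp: fun_eq_iff extensional_def ki prod_eq_iff fst_map_prod snd_map_prod)
    qed
    show "\<forall>u\<in>actions J. (\<lambda>a\<in>carrier A. \<lambda>j\<in>J. map_prod h id ((\<lambda>a\<in>carrier A. \<lambda>i\<in>I.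
        map_prod ?k id (u a (inv_into J ?k i))) a (?k j))) = u"
    proof
      fix u assume u: "u \<in> actions J"
      show "(\<lambda>a\<in>carrier A. \<lambda>j\<in>J. map_prod h id ((\<lambda>a\<in>carrier A. \<lambda>i\<in>I.
        map_prod ?k id (u a (inv_into J ?k i))) a (?k j))) = u"
        using actionsD(1,5,6)[OF u] h'
        by (auto simp: fun_eq_iff extensional_def prod_eq_iff fst_map_prod snd_map_prod)
    qed
  qed (use transport_in_actions[OF assms] transport_in_actions[OF k] in blast)+
qed

text \<open>Removing an orbit from \<open>{1..n}\<close> rarely leaves an initial segment, but only
  the number of remaining blocks matters.\<close>

lemma card_actions_cong:
  assumes "finite I" "card I = n"
  shows "card (actions I) = card (actions {1..n})" and "finite (actions I) \<longleftrightarrow> finite (actions {1..n})"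
proof -
  obtain h where "bij_betw h I {1..n}"
    using assms ex_bij_betw_finite_nat[of I] bij_betw_iff_card[of I "{1..n}"] by auto
  from bij_betw_transport[OF this] show "card (actions I) = card (actions {1..n})"
    "finite (actions I) \<longleftrightarrow> finite (actions {1..n})"
    by (auto dest: bij_betw_same_card bij_betw_finite)
qed

text \<open>Pairs of an action and a point are counted directly and through
  \<open>bij_betw_actions\<close>. For given L and \<open>\<phi>\<close>, the number of orbit maps
  and of remaining actions depends only on the index r.\<close>

lemma card_actions_rec:
  assumes finG: "finite (carrier G)"
    and finS: "\<And>r. 0 < r \<Longrightarrow> finite (subgroups_of_index r A)"
    and finH: "\<And>L. subgroup L A \<Longrightarrow> 0 < card (rcosets\<^bsub>A\<^esub> L) \<Longrightarrow> finite (Hom (A\<lparr>carrier := L\<rparr>) G)"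
    and finA: "\<And>n. finite (actions {1..n::nat})"
  shows "n * order G * card (actions {1..n}) =
    (\<Sum>r=1..n. \<Sum>L\<in>subgroups_of_index r A. card (Hom (A\<lparr>carrier := L\<rparr>) G) *
      ((\<Prod>i<r. n - i) * order G ^ r * card (actions {1..n - r})))"
proof -
  let ?I = "{1..n}"
  let ?S = "\<Union>r\<in>{1..n}. subgroups_of_index r A"
  let ?T = "\<lambda>S. SIGMA L:S. Hom (A\<lparr>carrier := L\<rparr>) G"
  let ?Q = "\<lambda>(L, \<phi>). SIGMA p:orbit_maps L \<phi> ?I. actions (?I - supp p)"
  have fin1: "finite (?T ?S)"
    using finS finH by (auto intro!: finite_SigmaI)
  have finR: "finite (rcosets\<^bsub>A\<^esub> L)" if "L \<in> ?S" for L
    using that by (auto intro!: card_ge_0_finite)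
  have card_rest: "card (actions (?I - supp p)) = card (actions {1..n - card (rcosets\<^bsub>A\<^esub> L)})"
    "finite (actions (?I - supp p))"
    if "subgroup L A" "\<phi> \<in> Hom (A\<lparr>carrier := L\<rparr>) G" "p \<in> orbit_maps L \<phi> ?I" for L \<phi> p
  proof -
    have "supp p \<subseteq> ?I"
      using orbit_mapsD(1)[OF that(3)] by auto
    then have "card (?I - supp p) = n - card (rcosets\<^bsub>A\<^esub> L)"
      using card_supp_orbit_map[OF that] by (simp add: card_Diff_subset finite_subset)
    then show "card (actions (?I - supp p)) = card (actions {1..n - card (rcosets\<^bsub>A\<^esub> L)})"
      "finite (actions (?I - supp p))"
      using card_actions_cong[of "?I - supp p"] finA by auto
  qed
  have fin2: "finite (?Q x)" if "x \<in> ?T ?S" for x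
  proof -
    from that obtain L \<phi> where x: "x = (L, \<phi>)" "L \<in> ?S" "subgroup L A" "\<phi> \<in> Hom (A\<lparr>carrier := L\<rparr>) G"
      by auto
    show ?thesis
      unfolding x(1) prod.case
      by (intro finite_SigmaI finite_orbit_maps[OF _ finG x(3,4) finR[OF x(2)]] card_rest(2)[OF x(3,4)]) auto
  qed
  have cardQ: "card (?Q x) = (\<Prod>i<card (rcosets\<^bsub>A\<^esub> fst x). n - i) *
      order G ^ card (rcosets\<^bsub>A\<^esub> fst x) * card (actions {1..n - card (rcosets\<^bsub>A\<^esub> fst x)})"
    if "x \<in> ?T ?S" for x
  proof -
    from that obtain L \<phi> where x: "x = (L, \<phi>)" "L \<in> ?S" "subgroup L A" "\<phi> \<in> Hom (A\<lparr>carrier := L\<rparr>) G"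
      by auto
    have "card (?Q x) = (\<Sum>p\<in>orbit_maps L \<phi> ?I. card (actions (?I - supp p)))"
      unfolding x(1) prod.case
      by (intro card_SigmaI finite_orbit_maps[OF _ finG x(3,4) finR[OF x(2)]] ballI
          card_rest(2)[OF x(3,4)]) auto
    also have "\<dots> = (\<Sum>p\<in>orbit_maps L \<phi> ?I. card (actions {1..n - card (rcosets\<^bsub>A\<^esub> L)}))"
      using x by (intro sum.cong card_rest(1)) auto
    finally show ?thesis
      using card_orbit_maps[OF _ finG x(3,4) finR[OF x(2)], of ?I] by (simp add: x(1))
  qed
  have "n * order G * card (actions ?I) = card (actions ?I \<times> (?I \<times> carrier G))"
    by (simp add: card_cartesian_product order_def)
  also have "\<dots> = card (Sigma (?T {L. subgroup L A}) ?Q)"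
    by (rule bij_betw_same_card[OF bij_betw_actions])
  \<comment> \<open>The orbit meets at least one and at most n blocks. This also excludes infinite
    index, which would show up as cardinality 0.\<close>
  also have "Sigma (?T {L. subgroup L A}) ?Q = Sigma (?T ?S) ?Q"
  proof (intro equalityI subsetI)
    fix z assume "z \<in> Sigma (?T {L. subgroup L A}) ?Q"
    then obtain L \<phi> p u where z: "z = ((L, \<phi>), p, u)" and L: "subgroup L A"
      "\<phi> \<in> Hom (A\<lparr>carrier := L\<rparr>) G" and p: "p \<in> orbit_maps L \<phi> ?I" "u \<in> actions (?I - supp p)"
      by auto
    have "supp p \<subseteq> ?I"
      using orbit_mapsD(1)[OF p(1)] by auto
    then have "card (supp p) \<le> n" "finite (supp p)"
      using card_mono[of ?I "supp p"] by (auto intro: finite_subset)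
    moreover have "supp p \<noteq> {}"
      by auto
    ultimately have "card (rcosets\<^bsub>A\<^esub> L) \<in> {1..n}"
      using card_supp_orbit_map[OF L p(1)] by (auto simp: Suc_le_eq card_gt_0_iff simp flip: card_supp_orbit_map[OF L p(1)])
    with z L p show "z \<in> Sigma (?T ?S) ?Q"
      by auto
  qed auto
  also have "card \<dots> = (\<Sum>x\<in>?T ?S. card (?Q x))"
    using fin1 fin2 by (intro card_SigmaI) auto
  also have "\<dots> = (\<Sum>(L, \<phi>)\<in>?T ?S. (\<Prod>i<card (rcosets\<^bsub>A\<^esub> L). n - i) *
      order G ^ card (rcosets\<^bsub>A\<^esub> L) * card (actions {1..n - card (rcosets\<^bsub>A\<^esub> L)}))"
  proof (rule sum.cong[OF refl])
    fix x assume "x \<in> ?T ?S"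
    from cardQ[OF this] show "card (?Q x) = (case x of (L, \<phi>) \<Rightarrow> (\<Prod>i<card (rcosets\<^bsub>A\<^esub> L). n - i) *
        order G ^ card (rcosets\<^bsub>A\<^esub> L) * card (actions {1..n - card (rcosets\<^bsub>A\<^esub> L)}))"
      by (simp only: case_prod_unfold)
  qed
  also have "\<dots> = (\<Sum>L\<in>?S. \<Sum>\<phi>\<in>Hom (A\<lparr>carrier := L\<rparr>) G. (\<Prod>i<card (rcosets\<^bsub>A\<^esub> L). n - i) *
      order G ^ card (rcosets\<^bsub>A\<^esub> L) * card (actions {1..n - card (rcosets\<^bsub>A\<^esub> L)}))"
    using finS finH by (intro sum.Sigma[symmetric]) auto
  also have "\<dots> = (\<Sum>L\<in>?S. card (Hom (A\<lparr>carrier := L\<rparr>) G) * ((\<Prod>i<card (rcosets\<^bsub>A\<^esub> L). n - i) *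
      order G ^ card (rcosets\<^bsub>A\<^esub> L) * card (actions {1..n - card (rcosets\<^bsub>A\<^esub> L)})))"
    by simp
  also have "\<dots> = (\<Sum>r=1..n. \<Sum>L\<in>subgroups_of_index r A. card (Hom (A\<lparr>carrier := L\<rparr>) G) *
      ((\<Prod>i<card (rcosets\<^bsub>A\<^esub> L). n - i) *
      order G ^ card (rcosets\<^bsub>A\<^esub> L) * card (actions {1..n - card (rcosets\<^bsub>A\<^esub> L)})))"
    using finS by (intro sum.UNION_disjoint) auto
  also have "\<dots> = (\<Sum>r=1..n. \<Sum>L\<in>subgroups_of_index r A. card (Hom (A\<lparr>carrier := L\<rparr>) G) *
      ((\<Prod>i<r. n - i) * order G ^ r * card (actions {1..n - r})))"
    by (intro sum.cong refl) auto
  finally show ?thesis .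
qed

end

section \<open>Wreath products\<close>

lemma carrier_wreath_product:
  "carrier (wreath_product G n) = ({1..n} \<rightarrow>\<^sub>E carrier G) \<times> {s. s permutes {1..n}}"
  by (auto simp: wreath_product_def semidirect_product_def sym_group_def)

lemma mult_wreath_product:
  "x \<otimes>\<^bsub>wreath_product G n\<^esub> y =
    (\<lambda>i\<in>{1..n}. fst x i \<otimes>\<^bsub>G\<^esub> fst y (inv_into UNIV (snd x) i), snd x \<circ> snd y)"
  by (auto simp: wreath_product_def semidirect_product_def sym_group_def case_prod_unfold fun_eq_iff)

lemma one_wreath_product: "\<one>\<^bsub>wreath_product G n\<^esub> = (\<lambda>i\<in>{1..n}. \<one>\<^bsub>G\<^esub>, id)"
  by (simp add: wreath_product_def semidirect_product_def sym_group_def)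

lemma order_wreath_product: "order (wreath_product G n) = order G ^ n * fact n"
  by (simp add: order_def carrier_wreath_product card_cartesian_product card_funcsetE card_permutations)

lemma finite_wreath_product: "finite (carrier G) \<Longrightarrow> finite (carrier (wreath_product G n))"
  by (auto simp: carrier_wreath_product intro!: finite_cartesian_product finite_PiE finite_permutations)

context twisted_actions begin

text \<open>\<^term>\<open>(g, s)\<close> in the wreath product acts on \<open>{1..n} \<times> G\<close> by
  \<open>(i, x) \<mapsto> (s i, g (s i) x)\<close>, commuting with right translations of the second component.\<close>

lemma bij_betw_Hom_wreath_product:
  "bij_betw (\<lambda>f. \<lambda>a\<in>carrier A. \<lambda>i\<in>{1..n}. (snd (f a) i, fst (f a) (snd (f a) i)))
    (Hom A (wreath_product G n)) (actions {1..n})"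
    (is "bij_betw ?F ?X ?Y")
proof -
  let ?I = "{1..n}" and ?W = "wreath_product G n"
  \<comment> \<open>Outside the blocks the identity is used, as \<open>permutes\<close>
    demands.\<close>
  define s where "s u a i = (if i \<in> ?I then fst (u a i) else i)" for u :: "'k \<Rightarrow> nat \<Rightarrow> nat \<times> 'a" and a i
  \<comment> \<open>The group component at position j is read off at the block that a moves to
    j.\<close>
  let ?H = "\<lambda>u. \<lambda>a\<in>carrier A. (\<lambda>j\<in>?I. snd (u a (s u (inv\<^bsub>A\<^esub> a) j)), s u a)"
  have X: "fst (f a) \<in> ?I \<rightarrow>\<^sub>E carrier G" "snd (f a) permutes ?I"
    if "f \<in> ?X" "a \<in> carrier A" for f a
    using HomD(1)[OF that] by (auto simp: carrier_wreath_product)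
  have X_one: "f \<one>\<^bsub>A\<^esub> = (\<lambda>i\<in>?I. \<one>\<^bsub>G\<^esub>, id)" if "f \<in> ?X" for f
    using that hom_one[of f A ?W] group_wreath_product[OF G.is_group]
    by (simp add: Hom_def A.is_group one_wreath_product)
  have X_inv: "snd (f (inv\<^bsub>A\<^esub> a)) (snd (f a) i) = i" if "f \<in> ?X" "a \<in> carrier A" for f a i
  proof -
    have "snd (f (inv\<^bsub>A\<^esub> a)) \<circ> snd (f a) = id"
      using HomD(2)[OF that(1), of "inv\<^bsub>A\<^esub> a" a] X_one[OF that(1)] that(2)
      by (simp add: mult_wreath_product)
    then show ?thesis
      by (simp add: fun_eq_iff)
  qed
  have Y_mult: "s u (a \<otimes>\<^bsub>A\<^esub> b) = s u a \<circ> s u b"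
    if "u \<in> ?Y" "a \<in> carrier A" "b \<in> carrier A" for u a b
    using actionsD(1,4)[OF that(1)] that(2,3) by (auto simp: s_def fun_eq_iff)
  have Y_inv: "s u (inv\<^bsub>A\<^esub> a) (s u a i) = i" if "u \<in> ?Y" "a \<in> carrier A" for u a i
    using actionsD(1)[OF that(1,2)] action_inverse[OF that(1,2)] by (auto simp: s_def)
  have Y_inv': "s u a (s u (inv\<^bsub>A\<^esub> a) i) = i" if "u \<in> ?Y" "a \<in> carrier A" for u a i
    using Y_inv[OF that(1), of "inv\<^bsub>A\<^esub> a"] that(2) by simp
  have Y_I: "s u a i \<in> ?I" if "u \<in> ?Y" "a \<in> carrier A" "i \<in> ?I" for u a i
    using actionsD(1)[OF that] that(3) by (simp add: s_def)
  have Y_permutes: "s u a permutes ?I" if "u \<in> ?Y" "a \<in> carrier A" for u a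
  proof (rule bij_imp_permutes)
    show "bij_betw (s u a) ?I ?I"
      using that Y_inv[OF that] Y_inv'[OF that] Y_I[OF that] Y_I[OF that(1) A.inv_closed[OF that(2)]]
      by (intro bij_betw_byWitness[where f' = "s u (inv\<^bsub>A\<^esub> a)"]) blast+
  qed (auto simp: s_def)
  have Y_inv_into: "inv_into UNIV (s u a) i = s u (inv\<^bsub>A\<^esub> a) i" if "u \<in> ?Y" "a \<in> carrier A" for u a i
    using permutes_inv_eq[OF Y_permutes[OF that]] Y_inv'[OF that] by blast
  show ?thesis
  proof (rule bij_betw_byWitness[where f' = ?H])
    show "?F ` ?X \<subseteq> ?Y"
    proof (rule image_subsetI)
      fix f assume f: "f \<in> ?X"
      show "?F f \<in> ?Y"
      proof (rule actionsI)
        fix a i assume "a \<in> carrier A" "i \<in> ?I"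
        then show "fst (?F f a i) \<in> ?I \<and> snd (?F f a i) \<in> carrier G"
          using X[OF f, of a] permutes_in_image[of "snd (f a)" ?I i] by auto
      next
        fix i assume "i \<in> ?I"
        then show "?F f \<one>\<^bsub>A\<^esub> i = (i, \<one>\<^bsub>G\<^esub>)"
          by (simp add: X_one[OF f])
      next
        fix a b i assume ab: "a \<in> carrier A" "b \<in> carrier A" and i: "i \<in> ?I"
        have "snd (f b) i \<in> ?I" "snd (f a) (snd (f b) i) \<in> ?I"
          using X(2)[OF f] ab i by (metis permutes_in_image)+
        then show "?F f (a \<otimes>\<^bsub>A\<^esub> b) i = ?F f a (fst (?F f b i)) \<odot> snd (?F f b i)"
          using ab i HomD(2)[OF f ab] permutes_inverses(2)[OF X(2)[OF f ab(1)]]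
          by (simp add: mult_wreath_product rtrans_def)
      qed auto
    qed
    show "?H ` ?Y \<subseteq> ?X"
    proof (rule image_subsetI)
      fix u assume u: "u \<in> ?Y"
      have "?H u \<in> hom A ?W"
      proof (rule homI)
        fix a assume a: "a \<in> carrier A"
        then show "?H u a \<in> carrier ?W"
          using Y_permutes[OF u a] actionsD(2)[OF u a] Y_I[OF u A.inv_closed[OF a]]
          by (auto simp: carrier_wreath_product)
      next
        fix a b assume ab: "a \<in> carrier A" "b \<in> carrier A"
        have "snd (u (a \<otimes>\<^bsub>A\<^esub> b) (s u (inv\<^bsub>A\<^esub> (a \<otimes>\<^bsub>A\<^esub> b)) j)) =
            snd (u a (s u (inv\<^bsub>A\<^esub> a) j)) \<otimes>\<^bsub>G\<^esub> snd (u b (s u (inv\<^bsub>A\<^esub> b) (s u (inv\<^bsub>A\<^esub> a) j)))"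
          if j: "j \<in> ?I" for j
        proof -
          \<comment> \<open>The block that the product of a and b moves to j.\<close>
          let ?k = "s u (inv\<^bsub>A\<^esub> b) (s u (inv\<^bsub>A\<^esub> a) j)"
          have k: "s u (inv\<^bsub>A\<^esub> (a \<otimes>\<^bsub>A\<^esub> b)) j = ?k"
            using ab Y_mult[OF u, of "inv\<^bsub>A\<^esub> b" "inv\<^bsub>A\<^esub> a"] by (simp add: A.inv_mult_group)
          have kI: "?k \<in> ?I"
            using ab by (intro Y_I[OF u] j) auto
          have "fst (u b ?k) = s u (inv\<^bsub>A\<^esub> a) j"
            using Y_inv'[OF u ab(2), of "s u (inv\<^bsub>A\<^esub> a) j"] kI unfolding s_def[of u b ?k] by simp
          then show ?thesis
            using actionsD(4)[OF u ab kI] by (simp add: k)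
        qed
        then show "?H u (a \<otimes>\<^bsub>A\<^esub> b) = ?H u a \<otimes>\<^bsub>?W\<^esub> ?H u b"
          using ab Y_I[OF u A.inv_closed[OF ab(1)]] Y_inv_into[OF u ab(1)]
          by (auto simp: mult_wreath_product Y_mult[OF u ab] simp del: atLeastAtMost_iff intro!: restrict_ext)
      qed
      then show "?H u \<in> ?X"
        by (simp add: Hom_def)
    qed
    show "\<forall>f\<in>?X. ?H (?F f) = f"
    proof
      fix f assume f: "f \<in> ?X"
      have sF: "s (?F f) a = snd (f a)" if "a \<in> carrier A" for a
        using that permutes_not_in[OF X(2)[OF f that]] by (auto simp: s_def fun_eq_iff)
      show "?H (?F f) = f"
      proof (rule extensionalityI[of _ "carrier A"])
        fix a assume a: "a \<in> carrier A"
        have inv: "snd (f (inv\<^bsub>A\<^esub> a)) j \<in> ?I" "snd (f a) (snd (f (inv\<^bsub>A\<^esub> a)) j) = j" if "j \<in> ?I" for j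
          using that a X(2)[OF f, of "inv\<^bsub>A\<^esub> a"] X_inv[OF f, of "inv\<^bsub>A\<^esub> a" j]
          by (simp_all add: permutes_in_image del: atLeastAtMost_iff)
        have "(\<lambda>j\<in>?I. snd (?F f a (s (?F f) (inv\<^bsub>A\<^esub> a) j))) = fst (f a)"
        proof (rule extensionalityI[of _ ?I])
          fix j assume j: "j \<in> ?I"
          then show "(\<lambda>j\<in>?I. snd (?F f a (s (?F f) (inv\<^bsub>A\<^esub> a) j))) j = fst (f a) j"
            unfolding sF[OF A.inv_closed[OF a]] using a inv[OF j]
            by (simp only: restrict_apply' snd_conv)
        qed (use X(1)[OF f a] in \<open>auto simp: PiE_def\<close>)
        then show "?H (?F f) a = f a"
          using a sF[OF a] by (simp add: prod_eq_iff)
      qed (use HomD(3)[OF f] in auto)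
    qed
    show "\<forall>u\<in>?Y. ?F (?H u) = u"
    proof
      fix u assume u: "u \<in> ?Y"
      show "?F (?H u) = u"
      proof (rule extensionalityI[of _ "carrier A"])
        fix a assume a: "a \<in> carrier A"
        show "?F (?H u) a = u a"
        proof (rule extensionalityI[of _ ?I])
          fix i assume i: "i \<in> ?I"
          then show "?F (?H u) a i = u a i"
            using a Y_I[OF u a i] Y_inv[OF u a, of i]
            by (simp add: prod_eq_iff s_def[of u a i] del: atLeastAtMost_iff)
        qed (use a actionsD(6)[OF u a] in auto)
      qed (use actionsD(5)[OF u] in auto)
    qed
  qed
qed

text \<open>This normalises the recursion: as G_0 has order 1, it gives a_0 = 1.\<close>

lemma card_actions_empty: "card (actions ({} :: 'i set)) = 1"
proof -
  have "actions ({} :: 'i set) = {\<lambda>a\<in>carrier A. \<lambda>i. undefined}"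
    by (auto simp: actions_def PiE_iff fun_eq_iff extensional_def)
  then show ?thesis by simp
qed

end

section \<open>The recursion for the numbers of conjugacy classes\<close>

lemma falling_factorial_times_fact:
  "r \<le> n \<Longrightarrow> (\<Prod>i<r. n - i) * fact (n - r) = (fact n :: nat)"
proof (induction r)
  case (Suc r)
  then have "fact (n - r) = (n - r) * (fact (n - Suc r) :: nat)"
    by (metis Suc_diff_Suc Suc_le_lessD fact_Suc of_nat_id)
  with Suc show ?case
    by (simp add: mult.assoc)
qed simp

lemma Hom_classes_wreath_product_rec:
  fixes G :: "('a, 'b) monoid_scheme" and d :: nat
  assumes "group G" "finite (carrier G)"
  defines "a \<equiv> \<lambda>n. card (Hom_classes (int_lattice d) (wreath_product G n))"
  shows "a 0 = 1"
    and "n * a n = card (Hom_classes (int_lattice d) G) *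
      (\<Sum>r=1..n. (\<Sum>k | k dvd r. k * num_subgroups_of_index k (int_lattice d)) * a (n - r))"
proof -
  let ?A = "int_lattice (Suc d)"
  let ?c = "card (Hom_classes (int_lattice d) G)"
  let ?g = "order G"
  interpret twisted_actions ?A G
    using assms(1) comm_group_int_lattice by (simp add: twisted_actions_def)
  have pos: "0 < ?g"
    using assms(2) G.one_closed by (auto simp: order_def card_gt_0_iff)
  have fin: "finite (actions {1..n::nat})" for n
    using finite_Hom_int_lattice[OF group_wreath_product[OF assms(1)] finite_wreath_product[OF assms(2)]]
      bij_betw_finite[OF bij_betw_Hom_wreath_product[of n]] by blast
  \<comment> \<open>Burnside's lemma in the wreath product, whose order is |G|^n n!.\<close>
  have card: "card (actions {1..n}) = a n * (?g ^ n * fact n)" for n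
    unfolding bij_betw_same_card[OF bij_betw_Hom_wreath_product, symmetric] a_def
      card_Hom_int_lattice_Suc[OF group_wreath_product[OF assms(1)] finite_wreath_product[OF assms(2)]]
      order_wreath_product ..
  show "a 0 = 1"
    using card[of 0] by (simp add: card_actions_empty)
  have HL: "\<exists>h. bij_betw h (Hom ?A G) (Hom (?A\<lparr>carrier := L\<rparr>) G)"
    if "subgroup L ?A" "0 < card (rcosets\<^bsub>?A\<^esub> L)" for L
    using finite_index_subgroup_int_lattice_iso[OF that]
      bij_betw_Hom_iso[OF subgroup.subgroup_is_group[OF that(1) A.is_group]]
    by (fastforce simp: is_iso_def)
  have finHL: "finite (Hom (?A\<lparr>carrier := L\<rparr>) G)"
    if "subgroup L ?A" "0 < card (rcosets\<^bsub>?A\<^esub> L)" for L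
    using HL[OF that] finite_Hom_int_lattice[OF assms(1,2)] bij_betw_finite by blast
  \<comment> \<open>L is again a lattice of rank d+1, so Burnside's lemma for G itself gives c |G|,
    whatever L is.\<close>
  have cardHL: "card (Hom (?A\<lparr>carrier := L\<rparr>) G) = ?c * ?g"
    if "subgroup L ?A" "0 < card (rcosets\<^bsub>?A\<^esub> L)" for L
    using HL[OF that] bij_betw_same_card card_Hom_int_lattice_Suc[OF assms(1,2)] by metis
  let ?S = "\<lambda>r. \<Sum>k | k dvd r. k * num_subgroups_of_index k (int_lattice d)"
  \<comment> \<open>The common factor |G|^(n+1) n! is carried along and cancelled at the end, which
    avoids division of natural numbers.\<close>
  have "(?g * ?g ^ n * fact n) * (n * a n) = n * ?g * card (actions {1..n})"
    unfolding card by (simp only: ac_simps)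
  also have "\<dots> = (\<Sum>r=1..n. \<Sum>L\<in>subgroups_of_index r ?A. card (Hom (?A\<lparr>carrier := L\<rparr>) G) *
      ((\<Prod>i<r. n - i) * ?g ^ r * card (actions {1..n - r})))"
    using assms(2) finite_subgroups_of_index_int_lattice finHL fin by (rule card_actions_rec)
  also have "\<dots> = (\<Sum>r=1..n. ?g * ?g ^ n * fact n * (?c * (?S r * a (n - r))))"
  proof (rule sum.cong[OF refl])
    fix r assume r: "r \<in> {1..n}"
    have "(\<Sum>L\<in>subgroups_of_index r ?A. card (Hom (?A\<lparr>carrier := L\<rparr>) G) *
        ((\<Prod>i<r. n - i) * ?g ^ r * card (actions {1..n - r}))) =
        (\<Sum>L\<in>subgroups_of_index r ?A. ?c * ?g * ((\<Prod>i<r. n - i) * ?g ^ r * card (actions {1..n - r})))"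
      using r by (intro sum.cong refl) (simp add: cardHL)
    also have "\<dots> = num_subgroups_of_index r ?A *
        (?c * ?g * ((\<Prod>i<r. n - i) * ?g ^ r * (a (n - r) * (?g ^ (n - r) * fact (n - r)))))"
      unfolding card by (simp add: num_subgroups_of_index_def)
    also have "\<dots> = num_subgroups_of_index r ?A *
        (?c * ?g * (((\<Prod>i<r. n - i) * fact (n - r)) * (?g ^ r * ?g ^ (n - r)) * a (n - r)))"
      by (simp only: ac_simps)
    \<comment> \<open>The falling factorial absorbs (n-r)!, the two powers of |G| merge, and the
      subgroup count in rank d+1 turns into the divisor sum in rank d.\<close>
    also have "\<dots> = ?S r * (?c * ?g * (fact n * ?g ^ n * a (n - r)))"
      using r num_subgroups_of_index_int_lattice_Suc[of r d] falling_factorial_times_fact[of r n]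
      by (simp flip: power_add)
    finally show "(\<Sum>L\<in>subgroups_of_index r ?A. card (Hom (?A\<lparr>carrier := L\<rparr>) G) *
        ((\<Prod>i<r. n - i) * ?g ^ r * card (actions {1..n - r}))) =
        ?g * ?g ^ n * fact n * (?c * (?S r * a (n - r)))"
      by (simp only: ac_simps)
  qed
  also have "\<dots> = (?g * ?g ^ n * fact n) * (?c * (\<Sum>r=1..n. ?S r * a (n - r)))"
    by (simp only: sum_distrib_left)
  finally show "n * a n = ?c * (\<Sum>r=1..n. ?S r * a (n - r))"
    using pos by simp
qed

theorem mainTheorem2:
  fixes G :: "('a, 'b) monoid_scheme" and d :: nat
  assumes "group G" and "finite (carrier G)"
  shows "(\<forall>r\<ge>1. num_subgroups_of_index r (int_lattice d) =
            (\<Sum>t \<in> {t \<in> {1..d} \<rightarrow>\<^sub>E {1..}. (\<Prod>i\<in>{1..d}. t i) = r}. \<Prod>i\<in>{1..d}. t i ^ (i - 1)))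
    \<and> convergent_prod
        (\<lambda>k. (1 - fps_X ^ Suc k :: int fps) ^ num_subgroups_of_index (Suc k) (int_lattice d))
    \<and> Abs_fps (\<lambda>n. int (card (Hom_classes (int_lattice d) (wreath_product G n)))) =
        fps_inverse_const1
          (prodinf (\<lambda>k. (1 - fps_X ^ Suc k) ^ num_subgroups_of_index (Suc k) (int_lattice d)))
          ^ card (Hom_classes (int_lattice d) G)"
proof (intro conjI allI impI)
  show "num_subgroups_of_index r (int_lattice d) =
      (\<Sum>t \<in> {t \<in> {1..d} \<rightarrow>\<^sub>E {1..}. (\<Prod>i\<in>{1..d}. t i) = r}. \<Prod>i\<in>{1..d}. t i ^ (i - 1))"
    if "1 \<le> r" for r
    using that by (intro num_subgroups_of_index_int_lattice) simp
  show "convergent_prod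
      (\<lambda>k. (1 - fps_X ^ Suc k :: int fps) ^ num_subgroups_of_index (Suc k) (int_lattice d))"
    by (rule convergent_prod_euler)
  show "Abs_fps (\<lambda>n. int (card (Hom_classes (int_lattice d) (wreath_product G n)))) =
      fps_inverse_const1
        (prodinf (\<lambda>k. (1 - fps_X ^ Suc k) ^ num_subgroups_of_index (Suc k) (int_lattice d)))
        ^ card (Hom_classes (int_lattice d) G)"
    unfolding prodinf_euler[of "\<lambda>r. num_subgroups_of_index r (int_lattice d)"]
    by (rule eq_inverse_euler_product_power) (rule Hom_classes_wreath_product_rec[OF assms])+
qed

end
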